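(* Let $\mathcal{E}$ be an exponential family on $(\Omega,dx)$ with densities $p(x;\theta)=\exp\{C(x)+\sum_{i=1}^n\theta_iF_i(x)-\psi(\theta)\}$, let $T\mathcal{E}$ carry its Kähler structure $(g,J,\omega)$, let $\pi:T\mathcal{E}\to\mathcal{E}$ be the canonical projection, and let $\mathcal{A}_{\mathcal{E}}$ be the real vector space spanned by $1,F_1,\dots,F_n:\Omega\to\mathbb{R}$. Then for every $X\in\mathcal{A}_{\mathcal{E}}$ and every holomorphic isometry $\Phi:T\mathcal{E}\to T\mathcal{E}$, the function $$T\mathcal{E}\to\mathbb{R},\qquad z\mapsto\int_\Omega X(x)\,\big[(\pi\circ\Phi)(z)\big](x)\,dx$$ is a Kähler function on $T\mathcal{E}$.
   Context: **Exponential families.** An exponential family $\mathcal{E}$ on a measured space $(\Omega,dx)$ (counting measure if $\Omega$ is discrete) is a set of probability density functions $p_\theta(x)=p(x;\theta)=\exp\{C(x)+\sum_{i=1}^n\theta_iF_i(x)-\psi(\theta)\}$, where $C,F_1,\dots,F_n$ are measurable, $\theta$ varies in an open subset $\Theta\subseteq\mathbb{R}^n$, and $\psi:\Theta\to\mathbb{R}$. Standing assumptions: $\{1,F_1,\dots,F_n\}$ is linearly independent, so that $\theta$ is a global chart of $\mathcal{E}$; $\psi$ is smooth; the expectation parameters $\eta_i(p_\theta)=\int_\Omega F_ip_\theta dx$ satisfy $\eta_i=\partial_{\theta_i}\psi$ and $\theta\mapsto(\partial_{\theta_1}\psi,\dots,\partial_{\theta_n}\psi)$ is a diffeomorphism onto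 its image; the Fisher metric and connections below are well defined and smooth. Fisher metric: $(h_F)_\theta(\partial_i,\partial_j)=E_{p_\theta}(\partial_i\ln p_\theta\cdot\partial_j\ln p_\theta)$, with $\partial_i=\partial/\partial\theta_i$. Exponential connection $\nabla^{(e)}$: Christoffel symbols $\Gamma_{ij,k}=E_{p_\theta}[(\partial_i\partial_j\ln p_\theta)\,\partial_k\ln p_\theta]$. **Kähler structure of $T\mathcal{E}$ (Dombrowski's construction for $h=h_F$, $\nabla=\nabla^{(e)}$).** Let $K:T(T\mathcal{E})\to T\mathcal{E}$ be the connector of $\nabla$. Identify $A\in T_{u_x}T\mathcal{E}$ with $(u_x,v_x,w_x)$, $v_x=\pi_*A$, $w_x=KA$. Set $g((u_x,v_x,w_x),(u_x,\bar v_x,\bar w_x))=h(v_x,\bar v_x)+h(w_x,\bar w_x)$, $\omega((u_x,v_x,w_x),(u_x,\bar v_x,\bar w_x))=h(v_x,\bar w_x)-h(w_x,\bar v_x)$, $J(u_x,v_x,w_x)=(u_x,-w_x,v_x)$. This is a Kähler structure on $T\mathcal{E}$. **Kähler functions.** On a Kähler manifold $(N,g,J,\omega)$, a smooth function $f:N\to\mathbb{R}$ is a Kähler function if $\mathscr{L}_{X_f}g=0$, where $X_f$ is defined by $\omega(X_f,\cdot)=df$ and $\mathscr{L}$ is the Lie derivative. A holomorphic isometry is a diffeomorphism preserving $g$ and $J$. *)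

theory Defs
  imports "HOL-Probability.Probability"
begin

section \<open>Calculus on open subsets of Euclidean space\<close>

(* C^k on an open set: all iterated directional derivatives up to order k exist and are
   continuous.  Only meant for open S, since "at x" is the unrestricted filter. *)
primrec ck_on :: "nat \<Rightarrow> 'a::euclidean_space set \<Rightarrow> ('a \<Rightarrow> 'b::euclidean_space) \<Rightarrow> bool" where
  "ck_on 0 S f \<longleftrightarrow> continuous_on S f"
| "ck_on (Suc k) S f \<longleftrightarrow>
     (\<forall>x\<in>S. f differentiable (at x)) \<and> (\<forall>v. ck_on k S (\<lambda>x. frechet_derivative f (at x) v))"

definition smooth_on :: "'a::euclidean_space set \<Rightarrow> ('a \<Rightarrow> 'b::euclidean_space) \<Rightarrow> bool" where
  "smooth_on S f \<longleftrightarrow> (\<forall>k. ck_on k S f)"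

definition diffeo_onto_image :: "'a::euclidean_space set \<Rightarrow> ('a \<Rightarrow> 'b::euclidean_space) \<Rightarrow> bool" where
  "diffeo_onto_image S f \<longleftrightarrow>
     smooth_on S f \<and> inj_on f S \<and> open (f ` S) \<and> smooth_on (f ` S) (inv_into S f)"

definition pderiv_at :: "'n \<Rightarrow> (real^'n \<Rightarrow> real) \<Rightarrow> real^'n \<Rightarrow> real" where
  "pderiv_at i f \<theta> = frechet_derivative f (at \<theta>) (axis i 1)"


section \<open>Kaehler functions and holomorphic isometries in a global chart\<close>

(* A manifold N with a global chart is given by an open set S of coordinates and a
   parametrization \<phi> with N = \<phi> ` S (\<phi> injective on S).  Tensors on N are written in these
   coordinates: g z a b, \<omega> z a b and J z a for z in S and coordinate tangent vectors a, b.
   Functions on N and maps from N to N live on N itself. *)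

definition lie_bracket :: "('a::euclidean_space \<Rightarrow> 'a) \<Rightarrow> ('a \<Rightarrow> 'a) \<Rightarrow> 'a \<Rightarrow> 'a" where
  "lie_bracket X Y z = frechet_derivative Y (at z) (X z) - frechet_derivative X (at z) (Y z)"

(* (L_X g)(Y,Z) = X(g(Y,Z)) - g([X,Y],Z) - g(Y,[X,Z]) *)
definition lie_derivative_form ::
    "('a::euclidean_space \<Rightarrow> 'a) \<Rightarrow> ('a \<Rightarrow> 'a \<Rightarrow> 'a \<Rightarrow> real) \<Rightarrow> ('a \<Rightarrow> 'a) \<Rightarrow> ('a \<Rightarrow> 'a) \<Rightarrow> 'a \<Rightarrow> real" where
  "lie_derivative_form X g Y Z z =
     frechet_derivative (\<lambda>z. g z (Y z) (Z z)) (at z) (X z)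
     - g z (lie_bracket X Y z) (Z z) - g z (Y z) (lie_bracket X Z z)"

(* X_f with \<omega>(X_f, .) = df; unique because \<omega> is nondegenerate *)
definition hamiltonian_field ::
    "('a::euclidean_space \<Rightarrow> 'a \<Rightarrow> 'a \<Rightarrow> real) \<Rightarrow> ('a \<Rightarrow> real) \<Rightarrow> 'a \<Rightarrow> 'a" where
  "hamiltonian_field \<omega> f z = (THE a. \<forall>b. \<omega> z a b = frechet_derivative f (at z) b)"

definition kaehler_function ::
    "'a::euclidean_space set \<Rightarrow> ('a \<Rightarrow> 'm) \<Rightarrow> ('a \<Rightarrow> 'a \<Rightarrow> 'a \<Rightarrow> real) \<Rightarrow> ('a \<Rightarrow> 'a \<Rightarrow> 'a \<Rightarrow> real)
     \<Rightarrow> ('m \<Rightarrow> real) \<Rightarrow> bool" where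
  "kaehler_function S \<phi> g \<omega> f \<longleftrightarrow>
     smooth_on S (f \<circ> \<phi>) \<and>
     (\<forall>Y Z. smooth_on S Y \<longrightarrow> smooth_on S Z \<longrightarrow>
        (\<forall>z\<in>S. lie_derivative_form (hamiltonian_field \<omega> (f \<circ> \<phi>)) g Y Z z = 0))"

definition coord_rep :: "'a set \<Rightarrow> ('a \<Rightarrow> 'm) \<Rightarrow> ('m \<Rightarrow> 'm) \<Rightarrow> 'a \<Rightarrow> 'a" where
  "coord_rep S \<phi> \<Phi> = inv_into S \<phi> \<circ> \<Phi> \<circ> \<phi>"

definition diffeomorphism :: "'a::euclidean_space set \<Rightarrow> ('a \<Rightarrow> 'm) \<Rightarrow> ('m \<Rightarrow> 'm) \<Rightarrow> bool" where
  "diffeomorphism S \<phi> \<Phi> \<longleftrightarrow>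
     bij_betw \<Phi> (\<phi> ` S) (\<phi> ` S) \<and>
     smooth_on S (coord_rep S \<phi> \<Phi>) \<and>
     smooth_on S (coord_rep S \<phi> (inv_into (\<phi> ` S) \<Phi>))"

definition holomorphic_isometry ::
    "'a::euclidean_space set \<Rightarrow> ('a \<Rightarrow> 'm) \<Rightarrow> ('a \<Rightarrow> 'a \<Rightarrow> 'a \<Rightarrow> real) \<Rightarrow> ('a \<Rightarrow> 'a \<Rightarrow> 'a)
     \<Rightarrow> ('m \<Rightarrow> 'm) \<Rightarrow> bool" where
  "holomorphic_isometry S \<phi> g J \<Phi> \<longleftrightarrow>
     diffeomorphism S \<phi> \<Phi> \<and>
     (\<forall>z\<in>S. let \<Psi> = coord_rep S \<phi> \<Phi>; D = frechet_derivative \<Psi> (at z) in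
        (\<forall>a b. g (\<Psi> z) (D a) (D b) = g z a b) \<and>
        (\<forall>a. D (J z a) = J (\<Psi> z) (D a)))"


section \<open>Dombrowski's construction\<close>

(* The base is an open subset of R^n with metric matrix h \<theta> and Christoffel symbols of the
   first kind \<Gamma> \<theta> i j k = h(\<nabla>_i \<partial>_j, \<partial>_k).  A point (\<theta>, u) is the tangent vector
   sum_i u_i \<partial>_i at \<theta>, and a pair (v, w) is a coordinate tangent vector at (\<theta>, u). *)

definition metric_of :: "(real^'n \<Rightarrow> real^'n^'n) \<Rightarrow> real^'n \<Rightarrow> real^'n \<Rightarrow> real^'n \<Rightarrow> real" where
  "metric_of h \<theta> v w = (\<Sum>i\<in>UNIV. \<Sum>j\<in>UNIV. h \<theta> $ i $ j * v $ i * w $ j)"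

(* \<Gamma>^k_ij = sum_l h^kl \<Gamma>_ij,l *)
definition christoffel2 ::
    "(real^'n \<Rightarrow> real^'n^'n) \<Rightarrow> (real^'n \<Rightarrow> 'n \<Rightarrow> 'n \<Rightarrow> 'n \<Rightarrow> real) \<Rightarrow> real^'n \<Rightarrow> 'n \<Rightarrow> 'n \<Rightarrow> 'n \<Rightarrow> real" where
  "christoffel2 h \<Gamma> \<theta> i j k = (\<Sum>l\<in>UNIV. matrix_inv (h \<theta>) $ k $ l * \<Gamma> \<theta> i j l)"

(* K maps the velocity of a curve t \<mapsto> (\<theta>(t), u(t)) to the covariant derivative of u along \<theta> *)
definition connector ::
    "(real^'n \<Rightarrow> real^'n^'n) \<Rightarrow> (real^'n \<Rightarrow> 'n \<Rightarrow> 'n \<Rightarrow> 'n \<Rightarrow> real)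
     \<Rightarrow> (real^'n) \<times> (real^'n) \<Rightarrow> (real^'n) \<times> (real^'n) \<Rightarrow> real^'n" where
  "connector h \<Gamma> z a =
     (\<chi> k. snd a $ k
        + (\<Sum>i\<in>UNIV. \<Sum>j\<in>UNIV. christoffel2 h \<Gamma> (fst z) i j k * fst a $ i * snd z $ j))"

(* the identification A \<mapsto> (\<pi>_* A, K A) *)
definition split_tangent ::
    "(real^'n \<Rightarrow> real^'n^'n) \<Rightarrow> (real^'n \<Rightarrow> 'n \<Rightarrow> 'n \<Rightarrow> 'n \<Rightarrow> real)
     \<Rightarrow> (real^'n) \<times> (real^'n) \<Rightarrow> (real^'n) \<times> (real^'n) \<Rightarrow> (real^'n) \<times> (real^'n)" where
  "split_tangent h \<Gamma> z a = (fst a, connector h \<Gamma> z a)"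

definition dombrowski_g ::
    "(real^'n \<Rightarrow> real^'n^'n) \<Rightarrow> (real^'n \<Rightarrow> 'n \<Rightarrow> 'n \<Rightarrow> 'n \<Rightarrow> real)
     \<Rightarrow> (real^'n) \<times> (real^'n) \<Rightarrow> (real^'n) \<times> (real^'n) \<Rightarrow> (real^'n) \<times> (real^'n) \<Rightarrow> real" where
  "dombrowski_g h \<Gamma> z a b =
     (let (v, w) = split_tangent h \<Gamma> z a; (v', w') = split_tangent h \<Gamma> z b
      in metric_of h (fst z) v v' + metric_of h (fst z) w w')"

definition dombrowski_omega ::
    "(real^'n \<Rightarrow> real^'n^'n) \<Rightarrow> (real^'n \<Rightarrow> 'n \<Rightarrow> 'n \<Rightarrow> 'n \<Rightarrow> real)
     \<Rightarrow> (real^'n) \<times> (real^'n) \<Rightarrow> (real^'n) \<times> (real^'n) \<Rightarrow> (real^'n) \<times> (real^'n) \<Rightarrow> real" where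
  "dombrowski_omega h \<Gamma> z a b =
     (let (v, w) = split_tangent h \<Gamma> z a; (v', w') = split_tangent h \<Gamma> z b
      in metric_of h (fst z) v w' - metric_of h (fst z) w v')"

definition dombrowski_J ::
    "(real^'n \<Rightarrow> real^'n^'n) \<Rightarrow> (real^'n \<Rightarrow> 'n \<Rightarrow> 'n \<Rightarrow> 'n \<Rightarrow> real)
     \<Rightarrow> (real^'n) \<times> (real^'n) \<Rightarrow> (real^'n) \<times> (real^'n) \<Rightarrow> (real^'n) \<times> (real^'n)" where
  "dombrowski_J h \<Gamma> z a =
     (let (v, w) = split_tangent h \<Gamma> z a in (THE b. split_tangent h \<Gamma> z b = (- w, v)))"

(* the THE in dombrowski_J is well defined *)
lemma bij_split_tangent: "bij (split_tangent h \<Gamma> z)"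
proof (rule bijI')
  fix a b
  show "split_tangent h \<Gamma> z a = split_tangent h \<Gamma> z b \<longleftrightarrow> a = b"
    by (auto simp: split_tangent_def connector_def prod_eq_iff vec_eq_iff)
next
  fix b
  show "\<exists>a. b = split_tangent h \<Gamma> z a"
    by (rule exI[of _ "(fst b, \<chi> k. snd b $ k
          - (\<Sum>i\<in>UNIV. \<Sum>j\<in>UNIV. christoffel2 h \<Gamma> (fst z) i j k * fst b $ i * snd z $ j))"])
       (simp add: split_tangent_def connector_def prod_eq_iff vec_eq_iff)
qed


section \<open>Exponential families\<close>

definition ef_density ::
    "('w \<Rightarrow> real) \<Rightarrow> ('n::finite \<Rightarrow> 'w \<Rightarrow> real) \<Rightarrow> (real^'n \<Rightarrow> real) \<Rightarrow> real^'n \<Rightarrow> 'w \<Rightarrow> real" where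
  "ef_density C F \<psi> \<theta> x = exp (C x + (\<Sum>i\<in>UNIV. \<theta> $ i * F i x) - \<psi> \<theta>)"

(* partial derivatives of the log-likelihood \<theta> \<mapsto> ln (p \<theta> x) *)
definition score :: "(real^'n \<Rightarrow> 'w \<Rightarrow> real) \<Rightarrow> 'n \<Rightarrow> real^'n \<Rightarrow> 'w \<Rightarrow> real" where
  "score p i \<theta> x = pderiv_at i (\<lambda>\<theta>. ln (p \<theta> x)) \<theta>"

definition score2 :: "(real^'n \<Rightarrow> 'w \<Rightarrow> real) \<Rightarrow> 'n \<Rightarrow> 'n \<Rightarrow> real^'n \<Rightarrow> 'w \<Rightarrow> real" where
  "score2 p i j \<theta> x = pderiv_at i (\<lambda>\<theta>. score p j \<theta> x) \<theta>"

definition fisher :: "'w measure \<Rightarrow> (real^'n \<Rightarrow> 'w \<Rightarrow> real) \<Rightarrow> real^'n \<Rightarrow> real^'n^'n" where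
  "fisher M p \<theta> = (\<chi> i j. \<integral>x. score p i \<theta> x * score p j \<theta> x * p \<theta> x \<partial>M)"

definition exp_christoffel ::
    "'w measure \<Rightarrow> (real^'n \<Rightarrow> 'w \<Rightarrow> real) \<Rightarrow> real^'n \<Rightarrow> 'n \<Rightarrow> 'n \<Rightarrow> 'n \<Rightarrow> real" where
  "exp_christoffel M p \<theta> i j k = (\<integral>x. score2 p i j \<theta> x * score p k \<theta> x * p \<theta> x \<partial>M)"

locale exponential_family =
  fixes M :: "'w measure"
    and \<Theta> :: "(real^'n) set"
    and C :: "'w \<Rightarrow> real"
    and F :: "'n::finite \<Rightarrow> 'w \<Rightarrow> real"
    and \<psi> :: "real^'n \<Rightarrow> real"
    and p :: "real^'n \<Rightarrow> 'w \<Rightarrow> real"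
  defines "p \<equiv> ef_density C F \<psi>"
  assumes open_param: "open \<Theta>"
    and measurable_C: "C \<in> borel_measurable M"
    and measurable_F: "\<And>i. F i \<in> borel_measurable M"
    and prob_density: "\<And>\<theta>. \<theta> \<in> \<Theta> \<Longrightarrow> prob_space (density M (\<lambda>x. ennreal (p \<theta> x)))"
    \<comment> \<open>linear independence as functions on the sample space, not merely almost everywhere\<close>
    and independent: "\<And>c0 (c :: real^'n).
          (\<forall>x\<in>space M. c0 + (\<Sum>i\<in>UNIV. c $ i * F i x) = 0) \<Longrightarrow> c0 = 0 \<and> c = 0"
    and smooth_psi: "smooth_on \<Theta> \<psi>"
    and integrable_F: "\<And>\<theta> i. \<theta> \<in> \<Theta> \<Longrightarrow> integrable M (\<lambda>x. F i x * p \<theta> x)"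
    and expectation_F: "\<And>\<theta> i. \<theta> \<in> \<Theta> \<Longrightarrow> (\<integral>x. F i x * p \<theta> x \<partial>M) = pderiv_at i \<psi> \<theta>"
    and diffeo_grad_psi: "diffeo_onto_image \<Theta> (\<lambda>\<theta>. (\<chi> i. pderiv_at i \<psi> \<theta>))"
    and fisher_integrable: "\<And>\<theta> i j. \<theta> \<in> \<Theta> \<Longrightarrow>
          integrable M (\<lambda>x. score p i \<theta> x * score p j \<theta> x * p \<theta> x)"
    and fisher_posdef: "\<And>\<theta> v. \<theta> \<in> \<Theta> \<Longrightarrow> v \<noteq> 0 \<Longrightarrow> 0 < metric_of (fisher M p) \<theta> v v"
    and fisher_smooth: "smooth_on \<Theta> (fisher M p)"
    and christoffel_integrable: "\<And>\<theta> i j k. \<theta> \<in> \<Theta> \<Longrightarrow>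
          integrable M (\<lambda>x. score2 p i j \<theta> x * score p k \<theta> x * p \<theta> x)"
    and christoffel_smooth: "\<And>i j k. smooth_on \<Theta> (\<lambda>\<theta>. exp_christoffel M p \<theta> i j k)"

(* The real span of 1, F_1, ..., F_n; membership only concerns values on the sample space. *)
definition statistics_span :: "'w measure \<Rightarrow> ('n::finite \<Rightarrow> 'w \<Rightarrow> real) \<Rightarrow> ('w \<Rightarrow> real) set" where
  "statistics_span M F = {X. \<exists>c0 (c :: real^'n). \<forall>x\<in>space M. X x = c0 + (\<Sum>i\<in>UNIV. c $ i * F i x)}"

(* The tangent vector sum_i u_i \<partial>_i at p \<theta>, realised as a pair: the density p \<theta> itself and the
   function x \<mapsto> sum_i u_i (\<partial>_i p)(x; \<theta>).  On \<Theta> \<times> R^n this parametrizes the tangent bundle of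
   the family of densities, and fst is the canonical projection. *)
definition tangent_param ::
    "(real^'n \<Rightarrow> 'w \<Rightarrow> real) \<Rightarrow> (real^'n) \<times> (real^'n) \<Rightarrow> ('w \<Rightarrow> real) \<times> ('w \<Rightarrow> real)" where
  "tangent_param p z = (p (fst z), \<lambda>x. frechet_derivative (\<lambda>\<theta>. p \<theta> x) (at (fst z)) (snd z))"

(* so tangent_param is a bijection from \<Theta> \<times> R^n onto the tangent bundle *)
lemma (in exponential_family) inj_on_tangent_param: "inj_on (tangent_param p) (\<Theta> \<times> UNIV)"
proof (rule inj_onI, clarify)
  fix \<theta> u \<theta>' u'
  assume \<theta>: "\<theta> \<in> \<Theta>" "\<theta>' \<in> \<Theta>" and eq: "tangent_param p (\<theta>, u) = tangent_param p (\<theta>', u')"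
  have peq: "p \<theta> = p \<theta>'"
    using eq by (simp add: tangent_param_def)
  have "(\<psi> \<theta>' - \<psi> \<theta>) + (\<Sum>i\<in>UNIV. (\<theta> - \<theta>') $ i * F i x) = 0" for x
  proof -
    from peq have "p \<theta> x = p \<theta>' x" by simp
    then show ?thesis
      by (simp add: p_def ef_density_def left_diff_distrib sum_subtractf)
  qed
  then have "\<theta> - \<theta>' = 0"
    using independent by blast
  then have same: "\<theta> = \<theta>'"
    by simp
  have "smooth_on \<Theta> \<psi>" by (rule smooth_psi)
  then have "ck_on (Suc 0) \<Theta> \<psi>" by (simp only: smooth_on_def)
  then have "\<psi> differentiable (at \<theta>)" using \<theta> by simp
  then have d\<psi>: "(\<psi> has_derivative frechet_derivative \<psi> (at \<theta>)) (at \<theta>)"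
    by (simp add: frechet_derivative_works)
  let ?D = "frechet_derivative \<psi> (at \<theta>)"
  have dp: "frechet_derivative (\<lambda>\<theta>. p \<theta> x) (at \<theta>) v = ((\<Sum>i\<in>UNIV. v $ i * F i x) - ?D v) * p \<theta> x" for x v
  proof -
    have "((\<lambda>\<theta>. \<Sum>i\<in>UNIV. \<theta> $ i * F i x) has_derivative (\<lambda>v. \<Sum>i\<in>UNIV. v $ i * F i x)) (at \<theta>)"
      by (intro has_derivative_sum has_derivative_mult_left
            bounded_linear.has_derivative[OF bounded_linear_vec_nth] has_derivative_ident)
    from has_derivative_exp[OF has_derivative_diff[OF has_derivative_add[OF has_derivative_const[of "C x"] this] d\<psi>]]
    have "((\<lambda>\<theta>. p \<theta> x) has_derivative
        (\<lambda>v. ((\<Sum>i\<in>UNIV. v $ i * F i x) - ?D v) * p \<theta> x)) (at \<theta>)"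
      unfolding p_def ef_density_def by (simp add: mult.commute)
    then show ?thesis
      by (simp add: frechet_derivative_at[symmetric])
  qed
  have dp_eq: "frechet_derivative (\<lambda>\<theta>. p \<theta> x) (at \<theta>) u = frechet_derivative (\<lambda>\<theta>. p \<theta> x) (at \<theta>) u'" for x
    using arg_cong[OF eq, of "\<lambda>t. snd t x"] by (simp only: same tangent_param_def fst_conv snd_conv)
  have pos: "p \<theta> x \<noteq> 0" for x
    by (simp add: p_def ef_density_def)
  have deq: "(\<Sum>i\<in>UNIV. u $ i * F i x) - ?D u = (\<Sum>i\<in>UNIV. u' $ i * F i x) - ?D u'" for x
    using dp_eq[of x, unfolded dp] mult_right_cancel[OF pos[of x]] by blast
  have "(?D u' - ?D u) + (\<Sum>i\<in>UNIV. (u - u') $ i * F i x) = 0" for x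
    using deq[of x] by (simp add: left_diff_distrib sum_subtractf)
  then have "u - u' = 0"
    using independent by blast
  then have "u = u'"
    by simp
  with same show "\<theta> = \<theta>' \<and> u = u'" by simp
qed

end

theory Submission
  imports Defs
begin

text \<open>
  In the natural parameters \<open>\<theta>\<close> and the induced fibre coordinates \<open>u\<close>, everything becomes explicit.
  The exponential connection is flat with vanishing Christoffel symbols (\<open>exp_christoffel_eq_0\<close>), so at
  a point \<open>(\<theta>, u)\<close> the Kaehler structure is \<open>g = h \<oplus> h\<close>,
  \<open>\<omega>((v, w), (v', w')) = h(v, w') - h(w, v')\<close> and \<open>J(v, w) = (- w, v)\<close>, where the Fisher metric
  \<open>h\<close> is taken at \<open>\<theta>\<close>.  The Fisher metric is the Hessian of \<open>\<psi>\<close> (\<open>fisher_eq_hessian\<close>).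

  The expectation of a statistic \<open>X = c\<^sub>0 + \<Sum>c\<^sub>i F\<^sub>i\<close> is \<open>c\<^sub>0 + \<Sum>c\<^sub>i \<partial>\<^sub>i\<psi>\<close>, whose differential is
  therefore \<open>(v, w) \<mapsto> h(c, v)\<close>.  This equals \<open>\<omega>((0, - c), (v, w))\<close>: the Hamiltonian field is the
  constant vertical field \<open>(0, - c)\<close>.  Its flow translates the fibres, along which the coefficients
  of \<open>g\<close> do not vary, so it is a Killing field.

  A holomorphic isometry \<open>\<Phi>\<close> preserves \<open>g\<close>, \<open>J\<close> and hence \<open>\<omega> = g(J \<cdot>, \<cdot>)\<close>.  So the Hamiltonian
  field of the composition with \<open>\<Phi>\<close> is the pullback of \<open>(0, - c)\<close>, and the pullback of a Killing
  field by an isometry is again a Killing field (\<open>kaehler_function_pullback_constant_field\<close>).  In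
  coordinates this last fact is a product-rule computation
  (\<open>lie_derivative_form_pullback_constant\<close>) whose second-order terms cancel by the symmetry of second
  derivatives (\<open>second_derivative_symmetric\<close>).
\<close>

section \<open>Smooth maps\<close>

lemma ck_on_cong:
  assumes "open S" and "\<And>x. x \<in> S \<Longrightarrow> f x = g x" and "ck_on k S f"
  shows "ck_on k S g"
  using assms(2,3)
proof (induction k arbitrary: f g)
  case 0
  then show ?case
    by (simp cong: continuous_on_cong)
next
  case (Suc k)
  have D: "f differentiable at x" if "x \<in> S" for x
    using Suc.prems that by simp
  have eq: "frechet_derivative f (at x) = frechet_derivative g (at x)" if "x \<in> S" for x
    using frechet_derivative_transform_within_open[OF D \<open>open S\<close>] that Suc.prems(1) by blast
  have "g differentiable at x" if "x \<in> S" for x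
    using D[OF that] has_derivative_transform_within_open[OF _ \<open>open S\<close> that] Suc.prems(1)
    unfolding differentiable_def by blast
  moreover have "ck_on k S (\<lambda>x. frechet_derivative g (at x) v)" for v
    using Suc.IH[of "\<lambda>x. frechet_derivative f (at x) v"] eq Suc.prems(2) by simp
  ultimately show ?case
    by simp
qed

lemma ck_on_SucI:
  assumes "open S"
    and "\<And>x. x \<in> S \<Longrightarrow> (f has_derivative f' x) (at x)"
    and "\<And>v. ck_on k S (\<lambda>x. f' x v)"
  shows "ck_on (Suc k) S f"
proof -
  have "f' x = frechet_derivative f (at x)" if "x \<in> S" for x
    using frechet_derivative_at assms(2)[OF that] by blast
  then have "ck_on k S (\<lambda>x. frechet_derivative f (at x) v)" for v
    using ck_on_cong[OF \<open>open S\<close> _ assms(3)[of v]] by simp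
  then show ?thesis
    using assms(2) by (auto simp: differentiable_def)
qed

lemma ck_on_has_derivative:
  assumes "ck_on (Suc k) S f" "x \<in> S"
  shows "(f has_derivative frechet_derivative f (at x)) (at x)"
  using assms by (simp flip: frechet_derivative_works)

lemma ck_on_Suc_imp: "ck_on (Suc k) S f \<Longrightarrow> ck_on k S f"
proof (induction k arbitrary: f)
  case 0
  then show ?case
    by (auto intro!: continuous_at_imp_continuous_on differentiable_imp_continuous_within)
next
  case (Suc k)
  then show ?case
    by (metis ck_on.simps(2))
qed

lemma ck_on_const: "ck_on k S (\<lambda>x. c)"
  by (induction k arbitrary: c) (simp_all)

lemma ck_on_bounded_linear_compose:
  assumes "open S" "bounded_linear L" "ck_on k S f"
  shows "ck_on k S (\<lambda>x. L (f x))"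
  using assms(3)
proof (induction k arbitrary: f)
  case 0
  then show ?case
    by (simp add: bounded_linear.continuous_on[OF assms(2)])
next
  case (Suc k)
  show ?case
  proof (rule ck_on_SucI[OF \<open>open S\<close>])
    show "((\<lambda>x. L (f x)) has_derivative (\<lambda>v. L (frechet_derivative f (at x) v))) (at x)"
      if "x \<in> S" for x
      by (rule bounded_linear.has_derivative[OF assms(2) ck_on_has_derivative[OF Suc.prems that]])
    show "ck_on k S (\<lambda>x. L (frechet_derivative f (at x) v))" for v
      using Suc by simp
  qed
qed

lemma ck_on_id: "open S \<Longrightarrow> ck_on k S (\<lambda>x. x)"
  by (cases k) (auto simp: ck_on_const)

lemma ck_on_bounded_linear: "open S \<Longrightarrow> bounded_linear L \<Longrightarrow> ck_on k S L"
  by (rule ck_on_bounded_linear_compose[OF _ _ ck_on_id, where L = L])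

lemma ck_on_add:
  assumes "open S" "ck_on k S f" "ck_on k S g"
  shows "ck_on k S (\<lambda>x. f x + g x)"
  using assms(2,3)
proof (induction k arbitrary: f g)
  case 0
  then show ?case
    by (simp add: continuous_on_add)
next
  case (Suc k)
  show ?case
    by (rule ck_on_SucI[OF \<open>open S\<close> has_derivative_add[OF ck_on_has_derivative[OF Suc.prems(1)]
          ck_on_has_derivative[OF Suc.prems(2)]]]) (use Suc in auto)
qed

lemma ck_on_sum:
  assumes "open S" "\<And>i. i \<in> I \<Longrightarrow> ck_on k S (f i)"
  shows "ck_on k S (\<lambda>x. \<Sum>i\<in>I. f i x)"
  using assms(2)
  by (induction I rule: infinite_finite_induct) (simp_all add: ck_on_const ck_on_add[OF \<open>open S\<close>])

lemma ck_on_scaleR: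
  assumes "open S" "ck_on k S r" "ck_on k S f"
  shows "ck_on k S (\<lambda>x. r x *\<^sub>R f x)"
  using assms(2,3)
proof (induction k arbitrary: r f)
  case 0
  then show ?case
    by (simp add: continuous_on_scaleR)
next
  case (Suc k)
  show ?case
  proof (rule ck_on_SucI[OF \<open>open S\<close> has_derivative_scaleR[OF ck_on_has_derivative[OF Suc.prems(1)]
          ck_on_has_derivative[OF Suc.prems(2)]]])
    show "ck_on k S (\<lambda>x. r x *\<^sub>R frechet_derivative f (at x) v
        + frechet_derivative r (at x) v *\<^sub>R f x)" for v
      using Suc.prems Suc.prems[THEN ck_on_Suc_imp]
      by (intro ck_on_add[OF \<open>open S\<close>] Suc.IH) simp_all
  qed
qed

text \<open>
  The chain rule gives derivatives of the form \<open>Dg (f x) (Df x v)\<close>, in which the differential of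
  \<open>g\<close> has a varying argument.  Expanding that argument in the standard basis turns the derivative into
  a sum of products of functions to which the induction hypothesis applies.
\<close>

lemma ck_on_compose:
  assumes "open S" "open T" "f ` S \<subseteq> T" "ck_on k S f" "ck_on k T g"
  shows "ck_on k S (\<lambda>x. g (f x))"
  using assms(4,5)
proof (induction k arbitrary: g)
  case 0
  then show ?case
    using continuous_on_compose2[OF _ _ assms(3)] by simp
next
  case (Suc k)
  show ?case
  proof (rule ck_on_SucI[OF \<open>open S\<close>])
    fix x assume x: "x \<in> S"
    then have "f x \<in> T"
      using assms(3) by auto
    from has_derivative_compose[OF ck_on_has_derivative[OF Suc.prems(1) x]
        ck_on_has_derivative[OF Suc.prems(2) this]]
    have "((\<lambda>x. g (f x)) has_derivative
        (\<lambda>v. frechet_derivative g (at (f x)) (frechet_derivative f (at x) v))) (at x)" .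
    moreover have "frechet_derivative g (at (f x)) (frechet_derivative f (at x) v) =
        (\<Sum>b\<in>Basis. (frechet_derivative f (at x) v \<bullet> b) *\<^sub>R frechet_derivative g (at (f x)) b)" for v
    proof -
      interpret linear "frechet_derivative g (at (f x))"
        by (rule has_derivative_linear[OF ck_on_has_derivative[OF Suc.prems(2) \<open>f x \<in> T\<close>]])
      have "frechet_derivative g (at (f x)) (\<Sum>b\<in>Basis. (frechet_derivative f (at x) v \<bullet> b) *\<^sub>R b) =
        (\<Sum>b\<in>Basis. (frechet_derivative f (at x) v \<bullet> b) *\<^sub>R frechet_derivative g (at (f x)) b)"
        by (simp only: sum scale)
      then show ?thesis
        by (simp only: euclidean_representation)
    qed
    ultimately show "((\<lambda>x. g (f x)) has_derivative
        (\<lambda>v. \<Sum>b\<in>Basis. (frechet_derivative f (at x) v \<bullet> b) *\<^sub>R frechet_derivative g (at (f x)) b)) (at x)"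
      by simp
  next
    fix v
    have "ck_on k S (\<lambda>x. frechet_derivative g (at (f x)) b)" for b
      using Suc.IH[of "\<lambda>y. frechet_derivative g (at y) b"] Suc.prems ck_on_Suc_imp by auto
    moreover have "ck_on k S (\<lambda>x. frechet_derivative f (at x) v \<bullet> b)" for b
      using Suc.prems by (intro ck_on_bounded_linear_compose[OF \<open>open S\<close> bounded_linear_inner_left]) auto
    ultimately show "ck_on k S (\<lambda>x. \<Sum>b\<in>Basis.
        (frechet_derivative f (at x) v \<bullet> b) *\<^sub>R frechet_derivative g (at (f x)) b)"
      by (intro ck_on_sum ck_on_scaleR \<open>open S\<close>)
  qed
qed

lemma smooth_on_differentiable:
  assumes "smooth_on S f" "x \<in> S"
  shows "f differentiable at x"
proof -
  have "ck_on (Suc 0) S f"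
    using assms(1) unfolding smooth_on_def by (rule spec)
  with assms(2) show ?thesis
    by simp
qed

lemma smooth_on_has_derivative:
  "smooth_on S f \<Longrightarrow> x \<in> S \<Longrightarrow> (f has_derivative frechet_derivative f (at x)) (at x)"
  by (simp add: smooth_on_differentiable flip: frechet_derivative_works)

lemma smooth_on_frechet_derivative:
  assumes "smooth_on S f"
  shows "smooth_on S (\<lambda>x. frechet_derivative f (at x) v)"
  unfolding smooth_on_def
proof
  fix k
  have "ck_on (Suc k) S f"
    using assms unfolding smooth_on_def by (rule spec)
  then show "ck_on k S (\<lambda>x. frechet_derivative f (at x) v)"
    by simp
qed

section \<open>Symmetry of second derivatives\<close>

text \<open>
  Two applications of the mean value theorem, first in direction \<open>v\<close> and then in direction \<open>w\<close>.
  The left-hand side of the equation is symmetric in \<open>v\<close> and \<open>w\<close>, which is what makes second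
  derivatives symmetric.
\<close>

lemma second_difference_mean_value:
  fixes f :: "'a::real_normed_vector \<Rightarrow> real"
  assumes f': "\<And>y. y \<in> S \<Longrightarrow> (f has_derivative f' y) (at y)"
    and f'': "\<And>y. y \<in> S \<Longrightarrow> ((\<lambda>y. f' y v) has_derivative f'' y) (at y)"
    and S: "cball x (s * (norm v + norm w)) \<subseteq> S" and s: "0 < s"
  shows "\<exists>y\<in>cball x (s * (norm v + norm w)).
    f (x + s *\<^sub>R v + s *\<^sub>R w) - f (x + s *\<^sub>R v) - f (x + s *\<^sub>R w) + f x = s\<^sup>2 * f'' y w"
proof -
  have mem: "x + t *\<^sub>R v + r *\<^sub>R w \<in> cball x (s * (norm v + norm w))"
    if "0 \<le> t" "t \<le> s" "0 \<le> r" "r \<le> s" for t r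
  proof -
    have "norm (t *\<^sub>R v + r *\<^sub>R w) \<le> t * norm v + r * norm w"
      using norm_triangle_ineq[of "t *\<^sub>R v" "r *\<^sub>R w"] that by simp
    also have "\<dots> \<le> s * norm v + s * norm w"
      using that by (intro add_mono mult_right_mono) auto
    also have "\<dots> = s * (norm v + norm w)"
      by (simp add: distrib_left)
    moreover have "x - (x + t *\<^sub>R v + r *\<^sub>R w) = - (t *\<^sub>R v + r *\<^sub>R w)"
      by simp
    ultimately show ?thesis
      by (simp only: mem_cball dist_norm norm_minus_cancel)
  qed
  have lin: "f' y (t *\<^sub>R a) = t * f' y a" if "y \<in> S" for y t a
    using linear_scale[OF has_derivative_linear[OF f'[OF that]]] by simp
  have lin2: "f'' y (t *\<^sub>R a) = t * f'' y a" if "y \<in> S" for y t a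
    using linear_scale[OF has_derivative_linear[OF f''[OF that]]] by simp
  let ?\<phi> = "\<lambda>t. f (x + t *\<^sub>R v + s *\<^sub>R w) - f (x + t *\<^sub>R v)"
  have der: "(?\<phi> has_derivative (\<lambda>h. h * (f' (x + t *\<^sub>R v + s *\<^sub>R w) v - f' (x + t *\<^sub>R v) v)))
      (at t within {0..s})" if "0 \<le> t" "t \<le> s" for t
  proof -
    have m: "x + t *\<^sub>R v + s *\<^sub>R w \<in> S" "x + t *\<^sub>R v \<in> S"
      using mem[of t s] mem[of t 0] that s S by auto
    have "((\<lambda>t. x + t *\<^sub>R v + s *\<^sub>R w) has_derivative (\<lambda>h. h *\<^sub>R v)) (at t within {0..s})"
      "((\<lambda>t. x + t *\<^sub>R v) has_derivative (\<lambda>h. h *\<^sub>R v)) (at t within {0..s})"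
      by (auto intro!: derivative_eq_intros)
    from has_derivative_diff[OF has_derivative_compose[OF this(1) f'[OF m(1)]]
      has_derivative_compose[OF this(2) f'[OF m(2)]]]
    show ?thesis
      by (simp add: lin m right_diff_distrib)
  qed
  obtain t where t: "t \<in> {0..s}"
    and \<phi>: "?\<phi> s - ?\<phi> 0 = s * (f' (x + t *\<^sub>R v + s *\<^sub>R w) v - f' (x + t *\<^sub>R v) v)"
    using mvt_very_simple[of 0 s ?\<phi>, OF _ der] s by auto
  let ?\<chi> = "\<lambda>r. f' (x + t *\<^sub>R v + r *\<^sub>R w) v"
  have der2: "(?\<chi> has_derivative (\<lambda>h. h * f'' (x + t *\<^sub>R v + r *\<^sub>R w) w))
      (at r within {0..s})" if "0 \<le> r" "r \<le> s" for r
  proof -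
    have m: "x + t *\<^sub>R v + r *\<^sub>R w \<in> S"
      using mem[of t r] that t S by auto
    have "((\<lambda>r. x + t *\<^sub>R v + r *\<^sub>R w) has_derivative (\<lambda>h. h *\<^sub>R w)) (at r within {0..s})"
      by (auto intro!: derivative_eq_intros)
    from has_derivative_compose[OF this f''[OF m]] show ?thesis
      by (simp add: lin2 m)
  qed
  obtain r where r: "r \<in> {0..s}" and \<chi>: "?\<chi> s - ?\<chi> 0 = s * f'' (x + t *\<^sub>R v + r *\<^sub>R w) w"
    using mvt_very_simple[of 0 s ?\<chi>, OF _ der2] s by auto
  show ?thesis
  proof (rule bexI[OF _ mem[of t r]])
    show "f (x + s *\<^sub>R v + s *\<^sub>R w) - f (x + s *\<^sub>R v) - f (x + s *\<^sub>R w) + f x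
        = s\<^sup>2 * f'' (x + t *\<^sub>R v + r *\<^sub>R w) w"
      using \<phi> \<chi> by (simp add: power2_eq_square)
  qed (use t r in auto)
qed

text \<open>
  The second difference quotient is at once a value of \<open>f'' \<cdot> v w\<close> and of \<open>f'' \<cdot> w v\<close> at two points
  that can be taken arbitrarily close to \<open>x\<close>; by continuity the values at \<open>x\<close> cannot differ.
\<close>

lemma second_derivative_symmetric_real:
  fixes f :: "'a::real_normed_vector \<Rightarrow> real"
  assumes "open S" "x \<in> S"
    and f': "\<And>y. y \<in> S \<Longrightarrow> (f has_derivative f' y) (at y)"
    and f'': "\<And>y u. y \<in> S \<Longrightarrow> ((\<lambda>y. f' y u) has_derivative f'' y u) (at y)"
    and cont: "\<And>u w. continuous_on S (\<lambda>y. f'' y u w)"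
  shows "f'' x v w = f'' x w v"
proof (rule ccontr)
  assume neq: "f'' x v w \<noteq> f'' x w v"
  let ?e = "\<bar>f'' x v w - f'' x w v\<bar> / 2"
  have "0 < ?e"
    using neq by simp
  obtain d where d: "0 < d" "cball x d \<subseteq> S"
    using \<open>open S\<close> \<open>x \<in> S\<close> open_contains_cball by blast
  have close: "\<exists>d>0. \<forall>y. dist y x < d \<longrightarrow> dist (f'' y u a) (f'' x u a) < ?e" for u a
  proof -
    have "isCont (\<lambda>y. f'' y u a) x"
      using cont \<open>open S\<close> \<open>x \<in> S\<close> continuous_on_eq_continuous_at by blast
    then show ?thesis
      using \<open>0 < ?e\<close> unfolding continuous_at_eps_delta by blast
  qed
  obtain d1 where d1: "0 < d1" "\<And>y. dist y x < d1 \<Longrightarrow> dist (f'' y v w) (f'' x v w) < ?e"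
    using close by blast
  obtain d2 where d2: "0 < d2" "\<And>y. dist y x < d2 \<Longrightarrow> dist (f'' y w v) (f'' x w v) < ?e"
    using close by blast
  define m where "m = min d (min d1 d2)"
  have m: "0 < m" "m \<le> d" "m \<le> d1" "m \<le> d2"
    using d d1 d2 by (auto simp: m_def)
  \<comment> \<open>the summand 1 keeps the denominator positive when both directions vanish\<close>
  define s where "s = m / (2 * (norm v + norm w + 1))"
  have N: "0 < norm v + norm w + 1"
    by (simp add: add_nonneg_pos)
  have s: "0 < s"
    using m N by (simp add: s_def)
  have "s * (norm v + norm w) \<le> s * (norm v + norm w + 1)"
    using s by simp
  also have "\<dots> = m / 2"
    using N by (simp add: s_def field_simps)
  finally have sm: "s * (norm v + norm w) < m"
    using m by simp
  have sub: "cball x (s * (norm v + norm w)) \<subseteq> S"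
    using sm m d by (meson cball_subset_cball_iff less_imp_le order_trans subset_cball)
  obtain y1 where y1: "y1 \<in> cball x (s * (norm v + norm w))"
    "f (x + s *\<^sub>R v + s *\<^sub>R w) - f (x + s *\<^sub>R v) - f (x + s *\<^sub>R w) + f x = s\<^sup>2 * f'' y1 v w"
    using second_difference_mean_value[OF f' f'' sub s] by blast
  have sub': "cball x (s * (norm w + norm v)) \<subseteq> S"
    using sub by (simp add: add.commute)
  obtain y2 where y2: "y2 \<in> cball x (s * (norm w + norm v))"
    "f (x + s *\<^sub>R w + s *\<^sub>R v) - f (x + s *\<^sub>R w) - f (x + s *\<^sub>R v) + f x = s\<^sup>2 * f'' y2 w v"
    using second_difference_mean_value[OF f' f'' sub' s] by blast
  have "s\<^sup>2 * f'' y1 v w = s\<^sup>2 * f'' y2 w v"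
    using y1(2) y2(2) by (simp add: algebra_simps)
  then have "f'' y1 v w = f'' y2 w v"
    using s by simp
  moreover have "dist (f'' y1 v w) (f'' x v w) < ?e"
    using y1(1) sm m by (intro d1(2)) (simp add: dist_commute)
  moreover have "dist (f'' y2 w v) (f'' x w v) < ?e"
    using y2(1) sm m by (intro d2(2)) (simp add: dist_commute add.commute)
  ultimately show False
    by (auto simp: dist_real_def abs_if split: if_splits)
qed

lemma second_derivative_symmetric:
  fixes f :: "'a::euclidean_space \<Rightarrow> 'b::euclidean_space"
  assumes S: "open S" "x \<in> S" and f: "ck_on (Suc (Suc 0)) S f"
  shows "frechet_derivative (\<lambda>y. frechet_derivative f (at y) v) (at x) w
       = frechet_derivative (\<lambda>y. frechet_derivative f (at y) w) (at x) v"
    (is "?D v w = ?D w v")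
proof -
  have "?D v w \<bullet> b = ?D w v \<bullet> b" for b
  proof (rule second_derivative_symmetric_real[OF S, where f = "\<lambda>y. f y \<bullet> b"
        and f' = "\<lambda>y u. frechet_derivative f (at y) u \<bullet> b"
        and f'' = "\<lambda>y u a. frechet_derivative (\<lambda>y. frechet_derivative f (at y) u) (at y) a \<bullet> b"])
    show "((\<lambda>y. f y \<bullet> b) has_derivative (\<lambda>u. frechet_derivative f (at y) u \<bullet> b)) (at y)"
      if "y \<in> S" for y
      by (rule has_derivative_inner_left[OF ck_on_has_derivative[OF f that]])
    show "((\<lambda>y. frechet_derivative f (at y) u \<bullet> b) has_derivative
      (\<lambda>a. frechet_derivative (\<lambda>y. frechet_derivative f (at y) u) (at y) a \<bullet> b)) (at y)"
      if "y \<in> S" for y u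
      using f that by (intro has_derivative_inner_left ck_on_has_derivative[where k = 0]) auto
    show "continuous_on S (\<lambda>y. frechet_derivative (\<lambda>y. frechet_derivative f (at y) u) (at y) a \<bullet> b)"
      for u a
    proof (rule continuous_on_inner[OF _ continuous_on_const])
      show "continuous_on S (\<lambda>y. frechet_derivative (\<lambda>y. frechet_derivative f (at y) u) (at y) a)"
        using f by simp
    qed
  qed
  then show ?thesis
    using vector_eq_rdot by blast
qed

section \<open>Killing fields\<close>

lemma bilinear_expand:
  fixes G :: "'a::euclidean_space \<Rightarrow> 'a \<Rightarrow> real"
  assumes "bilinear G"
  shows "G a b = (\<Sum>i\<in>Basis. \<Sum>j\<in>Basis. G i j * ((a \<bullet> i) * (b \<bullet> j)))"
proof -
  have "G a b = G (\<Sum>i\<in>Basis. (a \<bullet> i) *\<^sub>R i) (\<Sum>j\<in>Basis. (b \<bullet> j) *\<^sub>R j)"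
    by (simp only: euclidean_representation)
  also have "\<dots> = (\<Sum>(i, j)\<in>Basis \<times> Basis. G ((a \<bullet> i) *\<^sub>R i) ((b \<bullet> j) *\<^sub>R j))"
    by (rule bilinear_sum[OF assms])
  also have "\<dots> = (\<Sum>i\<in>Basis. \<Sum>j\<in>Basis. G i j * ((a \<bullet> i) * (b \<bullet> j)))"
    by (simp add: sum.cartesian_product bilinear_lmul[OF assms] bilinear_rmul[OF assms] ac_simps)
  finally show ?thesis .
qed

text \<open>
  The product rule for a varying bilinear form, along directions in which the form itself does not
  change to first order.  It follows from the ordinary product rule by writing the form through its
  values on the standard basis.
\<close>

lemma frechet_derivative_form_along:
  fixes G :: "'a::euclidean_space \<Rightarrow> 'a \<Rightarrow> 'a \<Rightarrow> real"
  assumes S: "open S" "z \<in> S" and bil: "\<forall>y\<in>S. bilinear (G (\<Psi> y))"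
    and G: "\<And>a b. (\<lambda>y. G y a b) differentiable at (\<Psi> z)"
    and \<Psi>: "(\<Psi> has_derivative \<Psi>') (at z)"
    and U: "(U has_derivative U') (at z)" and V: "(V has_derivative V') (at z)"
    and zero: "\<And>a b. frechet_derivative (\<lambda>y. G y a b) (at (\<Psi> z)) (\<Psi>' v) = 0"
  shows "(\<lambda>y. G (\<Psi> y) (U y) (V y)) differentiable at z" (is ?differentiable)
    and "frechet_derivative (\<lambda>y. G (\<Psi> y) (U y) (V y)) (at z) v
       = G (\<Psi> z) (U' v) (V z) + G (\<Psi> z) (U z) (V' v)" (is ?derivative)
proof -
  let ?G' = "\<lambda>i j. frechet_derivative (\<lambda>y. G y i j) (at (\<Psi> z))"
  have G\<Psi>: "((\<lambda>y. G (\<Psi> y) i j) has_derivative (\<lambda>h. ?G' i j (\<Psi>' h))) (at z)" for i j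
    using has_derivative_compose[OF \<Psi>] G frechet_derivative_works by blast
  have "((\<lambda>y. \<Sum>i\<in>Basis. \<Sum>j\<in>Basis. G (\<Psi> y) i j * ((U y \<bullet> i) * (V y \<bullet> j))) has_derivative
      (\<lambda>h. \<Sum>i\<in>Basis. \<Sum>j\<in>Basis. G (\<Psi> z) i j * ((U z \<bullet> i) * (V' h \<bullet> j) + (U' h \<bullet> i) * (V z \<bullet> j))
        + ?G' i j (\<Psi>' h) * ((U z \<bullet> i) * (V z \<bullet> j)))) (at z)"
    by (intro has_derivative_sum has_derivative_mult G\<Psi> has_derivative_inner_left U V)
  then have has: "((\<lambda>y. G (\<Psi> y) (U y) (V y)) has_derivative
      (\<lambda>h. \<Sum>i\<in>Basis. \<Sum>j\<in>Basis. G (\<Psi> z) i j * ((U z \<bullet> i) * (V' h \<bullet> j) + (U' h \<bullet> i) * (V z \<bullet> j))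
        + ?G' i j (\<Psi>' h) * ((U z \<bullet> i) * (V z \<bullet> j)))) (at z)"
    by (rule has_derivative_transform_within_open[OF _ S]) (rule bilinear_expand[OF bil[rule_format], symmetric])
  then show ?differentiable
    by (rule differentiableI)
  from has have "frechet_derivative (\<lambda>y. G (\<Psi> y) (U y) (V y)) (at z) v =
      (\<Sum>i\<in>Basis. \<Sum>j\<in>Basis. G (\<Psi> z) i j * ((U z \<bullet> i) * (V' v \<bullet> j) + (U' v \<bullet> i) * (V z \<bullet> j)))"
    by (simp add: frechet_derivative_at[symmetric] zero)
  also have "\<dots> = (\<Sum>i\<in>Basis. \<Sum>j\<in>Basis. G (\<Psi> z) i j * ((U' v \<bullet> i) * (V z \<bullet> j)))
      + (\<Sum>i\<in>Basis. \<Sum>j\<in>Basis. G (\<Psi> z) i j * ((U z \<bullet> i) * (V' v \<bullet> j)))"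
    by (simp add: distrib_left sum.distrib add.commute)
  also have "\<dots> = G (\<Psi> z) (U' v) (V z) + G (\<Psi> z) (U z) (V' v)"
    by (simp only: bilinear_expand[OF bil[rule_format, OF S(2)], of "U' v" "V z"]
        bilinear_expand[OF bil[rule_format, OF S(2)], of "U z" "V' v"])
  finally show ?derivative .
qed

text \<open>
  The product rule for \<open>D\<Psi> y (Y y)\<close>; as before, the varying argument of the differential is
  expanded in the standard basis.
\<close>

lemma has_derivative_pushforward:
  fixes \<Psi> :: "'a::euclidean_space \<Rightarrow> 'b::euclidean_space"
  assumes S: "open S" "z \<in> S" and \<Psi>: "ck_on (Suc (Suc 0)) S \<Psi>"
    and Y: "Y differentiable at z"
  shows "((\<lambda>y. frechet_derivative \<Psi> (at y) (Y y)) has_derivative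
      (\<lambda>h. frechet_derivative (\<lambda>y. frechet_derivative \<Psi> (at y) (Y z)) (at z) h
        + frechet_derivative \<Psi> (at z) (frechet_derivative Y (at z) h))) (at z)"
proof -
  let ?D = "\<lambda>y. frechet_derivative \<Psi> (at y)"
  have lin: "linear (?D y)" if "y \<in> S" for y
    by (rule has_derivative_linear[OF ck_on_has_derivative[OF \<Psi> that]])
  have expand: "?D y a = (\<Sum>b\<in>Basis. (a \<bullet> b) *\<^sub>R ?D y b)" if "y \<in> S" for y a
  proof -
    have "?D y (\<Sum>b\<in>Basis. (a \<bullet> b) *\<^sub>R b) = (\<Sum>b\<in>Basis. (a \<bullet> b) *\<^sub>R ?D y b)"
      by (simp only: linear_sum[OF lin[OF that]] linear_scale[OF lin[OF that]])
    then show ?thesis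
      by (simp only: euclidean_representation)
  qed
  let ?DD = "\<lambda>b. frechet_derivative (\<lambda>y. ?D y b) (at z)"
  have DD: "((\<lambda>y. ?D y b) has_derivative ?DD b) (at z)" for b
    using \<Psi> S by (intro ck_on_has_derivative[where k = 0]) auto
  have "((\<lambda>y. \<Sum>b\<in>Basis. (Y z \<bullet> b) *\<^sub>R ?D y b) has_derivative
      (\<lambda>h. \<Sum>b\<in>Basis. (Y z \<bullet> b) *\<^sub>R ?DD b h)) (at z)"
    by (intro has_derivative_sum has_derivative_scaleR_right DD)
  \<comment> \<open>the second differential of \<open>\<Psi>\<close> is linear in the frozen argument \<open>Y z\<close>\<close>
  then have "((\<lambda>y. ?D y (Y z)) has_derivative (\<lambda>h. \<Sum>b\<in>Basis. (Y z \<bullet> b) *\<^sub>R ?DD b h)) (at z)"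
    by (rule has_derivative_transform_within_open[OF _ S]) (rule expand[symmetric])
  from has_derivative_unique[OF DD this]
  have DDY: "?DD (Y z) h = (\<Sum>b\<in>Basis. (Y z \<bullet> b) *\<^sub>R ?DD b h)" for h
    by (rule fun_cong)
  have "(Y has_derivative frechet_derivative Y (at z)) (at z)"
    using Y frechet_derivative_works by blast
  then have "((\<lambda>y. \<Sum>b\<in>Basis. (Y y \<bullet> b) *\<^sub>R ?D y b) has_derivative
      (\<lambda>h. \<Sum>b\<in>Basis. (Y z \<bullet> b) *\<^sub>R ?DD b h + (frechet_derivative Y (at z) h \<bullet> b) *\<^sub>R ?D z b)) (at z)"
    by (intro has_derivative_sum has_derivative_scaleR has_derivative_inner_left DD)
  then have "((\<lambda>y. ?D y (Y y)) has_derivative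
      (\<lambda>h. \<Sum>b\<in>Basis. (Y z \<bullet> b) *\<^sub>R ?DD b h + (frechet_derivative Y (at z) h \<bullet> b) *\<^sub>R ?D z b)) (at z)"
    by (rule has_derivative_transform_within_open[OF _ S]) (rule expand[symmetric])
  then show ?thesis
    by (simp only: sum.distrib DDY[symmetric] expand[OF S(2), symmetric])
qed

text \<open>
  Differentiating the constant \<open>D\<Psi> W = c\<close> along \<open>Y\<close> gives \<open>D\<^sup>2\<Psi>(Y, W) = - D\<Psi> (DW Y)\<close>.  By the
  symmetry of \<open>D\<^sup>2\<Psi>\<close> this is the second-order term in the derivative of \<open>D\<Psi> Y\<close> along \<open>W\<close>, and
  the remaining terms are those of the bracket.  This is the naturality of the bracket, for a field
  that is \<open>\<Psi>\<close>-related to a constant one.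
\<close>

lemma pushforward_lie_bracket_constant:
  fixes \<Psi> :: "'a::euclidean_space \<Rightarrow> 'a"
  assumes S: "open S" "z \<in> S" and \<Psi>: "ck_on (Suc (Suc 0)) S \<Psi>"
    and W: "W differentiable at z" "\<And>y. y \<in> S \<Longrightarrow> frechet_derivative \<Psi> (at y) (W y) = c"
    and Y: "Y differentiable at z"
  shows "frechet_derivative (\<lambda>y. frechet_derivative \<Psi> (at y) (Y y)) (at z) (W z)
       = frechet_derivative \<Psi> (at z) (lie_bracket W Y z)"
proof -
  let ?D = "\<lambda>y. frechet_derivative \<Psi> (at y)"
  let ?DD = "\<lambda>b. frechet_derivative (\<lambda>y. ?D y b) (at z)"
  have "((\<lambda>y. ?D y (W y)) has_derivative (\<lambda>h. 0)) (at z)"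
    by (rule has_derivative_transform_within_open[OF has_derivative_const[of c] S]) (simp add: W)
  from has_derivative_unique[OF has_derivative_pushforward[OF S \<Psi> W(1)] this]
  have "?DD (W z) (Y z) + ?D z (frechet_derivative W (at z) (Y z)) = 0"
    by (rule fun_cong)
  moreover have "?DD (Y z) (W z) = ?DD (W z) (Y z)"
    by (rule second_derivative_symmetric[OF S \<Psi>])
  ultimately have "?DD (Y z) (W z) = - ?D z (frechet_derivative W (at z) (Y z))"
    by (simp add: eq_neg_iff_add_eq_0)
  moreover have "linear (?D z)"
    by (rule has_derivative_linear[OF ck_on_has_derivative[OF \<Psi> S(2)]])
  ultimately show ?thesis
    by (simp add: frechet_derivative_at[OF has_derivative_pushforward[OF S \<Psi> Y], symmetric]
        lie_bracket_def linear_diff)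
qed

text \<open>
  If translation in direction \<open>c\<close> preserves \<open>G\<close>, then the pullback \<open>W\<close> of the constant field \<open>c\<close>
  along a map preserving \<open>G\<close> is a Killing field: \<open>G y (Y y) (Z y)\<close> may be computed at \<open>\<Psi> y\<close> from
  the images of \<open>Y\<close> and \<open>Z\<close>, where its derivative along \<open>W\<close> sees no variation of \<open>G\<close>, and the
  derivatives of the two images are the images of the brackets.
\<close>

lemma lie_derivative_form_pullback_constant:
  fixes G :: "'a::euclidean_space \<Rightarrow> 'a \<Rightarrow> 'a \<Rightarrow> real"
  assumes S: "open S" and z: "z \<in> S"
    and \<Psi>: "ck_on (Suc (Suc 0)) S \<Psi>" "\<Psi> ` S \<subseteq> S"
    and isometry: "\<And>y a b. y \<in> S \<Longrightarrow>
      G (\<Psi> y) (frechet_derivative \<Psi> (at y) a) (frechet_derivative \<Psi> (at y) b) = G y a b"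
    and W: "W differentiable at z" "\<And>y. y \<in> S \<Longrightarrow> frechet_derivative \<Psi> (at y) (W y) = c"
    and G: "\<And>y. y \<in> S \<Longrightarrow> bilinear (G y)" "\<And>y a b. y \<in> S \<Longrightarrow> (\<lambda>y. G y a b) differentiable at y"
    and invariant: "\<And>y a b. y \<in> S \<Longrightarrow> frechet_derivative (\<lambda>y. G y a b) (at y) c = 0"
    and Y: "Y differentiable at z" and Z: "Z differentiable at z"
  shows "lie_derivative_form W G Y Z z = 0"
proof -
  let ?D = "\<lambda>y. frechet_derivative \<Psi> (at y)"
  have \<Psi>z: "\<Psi> y \<in> S" if "y \<in> S" for y
    using \<Psi>(2) that by auto
  have push: "((\<lambda>y. ?D y (V y)) has_derivative frechet_derivative (\<lambda>y. ?D y (V y)) (at z)) (at z)"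
    if "V differentiable at z" for V
    using has_derivative_pushforward[OF S z \<Psi>(1) that] by (auto simp: frechet_derivative_works[symmetric] differentiable_def)
  let ?pull = "\<lambda>y. G (\<Psi> y) (?D y (Y y)) (?D y (Z y))"
  have zero: "frechet_derivative (\<lambda>y. G y a b) (at (\<Psi> z)) (?D z (W z)) = 0" for a b
    using invariant[OF \<Psi>z[OF z]] W(2)[OF z] by simp
  have "\<forall>y\<in>S. bilinear (G (\<Psi> y))"
    using G(1) \<Psi>z by blast
  note along = frechet_derivative_form_along[OF S z this G(2)[OF \<Psi>z[OF z]]
      ck_on_has_derivative[OF \<Psi>(1) z] push[OF Y] push[OF Z] zero]
  have "frechet_derivative (\<lambda>y. G y (Y y) (Z y)) (at z) = frechet_derivative ?pull (at z)"
    by (rule frechet_derivative_transform_within_open[OF along(1) S z, symmetric]) (rule isometry)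
  then have "frechet_derivative (\<lambda>y. G y (Y y) (Z y)) (at z) (W z)
      = G (\<Psi> z) (?D z (lie_bracket W Y z)) (?D z (Z z))
        + G (\<Psi> z) (?D z (Y z)) (?D z (lie_bracket W Z z))"
    by (simp only: along(2) pushforward_lie_bracket_constant[OF S z \<Psi>(1) W Y]
        pushforward_lie_bracket_constant[OF S z \<Psi>(1) W Z])
  then show ?thesis
    by (simp add: lie_derivative_form_def isometry[OF z])
qed

section \<open>Pulling back Kaehler functions\<close>

lemma diffeomorphism_coord_rep:
  assumes inj: "inj_on \<phi> S" and \<Phi>: "diffeomorphism S \<phi> \<Phi>" and z: "z \<in> S"
  defines "\<Psi> \<equiv> coord_rep S \<phi> \<Phi>" and "\<Psi>' \<equiv> coord_rep S \<phi> (inv_into (\<phi> ` S) \<Phi>)"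
  shows "\<Psi> z \<in> S" "\<phi> (\<Psi> z) = \<Phi> (\<phi> z)" "\<Psi>' z \<in> S" "\<Psi>' (\<Psi> z) = z" "\<Psi> (\<Psi>' z) = z"
proof -
  have bij: "bij_betw \<Phi> (\<phi> ` S) (\<phi> ` S)"
    using \<Phi> by (simp add: diffeomorphism_def)
  have bij': "bij_betw (inv_into (\<phi> ` S) \<Phi>) (\<phi> ` S) (\<phi> ` S)"
    by (rule bij_betw_inv_into[OF bij])
  have *: "\<Phi> (\<phi> y) \<in> \<phi> ` S" "inv_into (\<phi> ` S) \<Phi> (\<phi> y) \<in> \<phi> ` S" if "y \<in> S" for y
    using bij_betw_apply[OF bij] bij_betw_apply[OF bij'] that by blast+
  show 1: "\<Psi> z \<in> S" and 2: "\<phi> (\<Psi> z) = \<Phi> (\<phi> z)"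
    using *(1)[OF z] by (simp_all add: \<Psi>_def coord_rep_def inv_into_into f_inv_into_f)
  show 3: "\<Psi>' z \<in> S"
    using *(2)[OF z] by (simp add: \<Psi>'_def coord_rep_def inv_into_into)
  have 4: "\<phi> (\<Psi>' z) = inv_into (\<phi> ` S) \<Phi> (\<phi> z)"
    using *(2)[OF z] by (simp add: \<Psi>'_def coord_rep_def f_inv_into_f)
  show "\<Psi>' (\<Psi> z) = z"
    using 2 z bij by (simp add: \<Psi>'_def coord_rep_def inj inv_into_f_f bij_betw_inv_into_left)
  show "\<Psi> (\<Psi>' z) = z"
    using 4 z bij by (simp add: \<Psi>_def coord_rep_def inj inv_into_f_f bij_betw_inv_into_right)
qed

lemma frechet_derivative_inverse:
  fixes \<Psi> :: "'a::euclidean_space \<Rightarrow> 'a"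
  assumes S: "open S" "y \<in> S" and \<Psi>': "\<Psi>' differentiable at y"
    and \<Psi>: "\<Psi> differentiable at (\<Psi>' y)" and inv: "\<And>y. y \<in> S \<Longrightarrow> \<Psi> (\<Psi>' y) = y"
  shows "frechet_derivative \<Psi> (at (\<Psi>' y)) (frechet_derivative \<Psi>' (at y) a) = a"
proof -
  have "((\<lambda>y. \<Psi> (\<Psi>' y)) has_derivative
      (\<lambda>h. frechet_derivative \<Psi> (at (\<Psi>' y)) (frechet_derivative \<Psi>' (at y) h))) (at y)"
    using has_derivative_compose \<Psi> \<Psi>' frechet_derivative_works by blast
  moreover have "((\<lambda>y. \<Psi> (\<Psi>' y)) has_derivative (\<lambda>h. h)) (at y)"
    by (rule has_derivative_transform_within_open[OF has_derivative_ident S]) (simp add: inv)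
  ultimately show ?thesis
    by (rule fun_cong[OF has_derivative_unique])
qed

text \<open>
  A holomorphic isometry preserves \<open>\<omega> = g(J \<cdot>, \<cdot>)\<close>, so it pulls the Hamiltonian field of \<open>f\<close> back
  to that of \<open>f \<circ> \<Phi>\<close>.  When the former is the constant field \<open>c\<close>, the latter is
  \<open>W = (D\<Psi>)\<^sup>-\<^sup>1 c\<close>, a Killing field by
  \<open>lie_derivative_form_pullback_constant\<close>.  Nondegeneracy of \<open>\<omega>\<close> makes Hamiltonian fields unique.
\<close>

lemma kaehler_function_pullback_constant_field:
  fixes S :: "'a::euclidean_space set"
  assumes S: "open S" "inj_on \<phi> S" and \<Phi>: "holomorphic_isometry S \<phi> g J \<Phi>"
    and \<omega>: "\<And>z a b. z \<in> S \<Longrightarrow> \<omega> z a b = g z (J z a) b"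
    and nondegenerate: "\<And>z a a'. z \<in> S \<Longrightarrow> (\<And>b. \<omega> z a b = \<omega> z a' b) \<Longrightarrow> a = a'"
    and g: "\<And>z. z \<in> S \<Longrightarrow> bilinear (g z)" "\<And>z a b. z \<in> S \<Longrightarrow> (\<lambda>z. g z a b) differentiable at z"
    and f: "smooth_on S f" "\<And>z b. z \<in> S \<Longrightarrow> \<omega> z c b = frechet_derivative f (at z) b"
    and invariant: "\<And>z a b. z \<in> S \<Longrightarrow> frechet_derivative (\<lambda>z. g z a b) (at z) c = 0"
    and F: "\<And>z. z \<in> S \<Longrightarrow> F (\<phi> z) = f (coord_rep S \<phi> \<Phi> z)"
  shows "kaehler_function S \<phi> g \<omega> F"
proof -
  define \<Psi> where "\<Psi> = coord_rep S \<phi> \<Phi>"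
  define \<Psi>' where "\<Psi>' = coord_rep S \<phi> (inv_into (\<phi> ` S) \<Phi>)"
  have diffeo: "diffeomorphism S \<phi> \<Phi>"
    using \<Phi> by (simp add: holomorphic_isometry_def)
  have smooth: "smooth_on S \<Psi>" "smooth_on S \<Psi>'"
    using diffeo by (simp_all add: diffeomorphism_def \<Psi>_def \<Psi>'_def)
  note coord = diffeomorphism_coord_rep[OF S(2) diffeo, folded \<Psi>_def \<Psi>'_def]
  let ?D = "\<lambda>z. frechet_derivative \<Psi> (at z)"
  have iso: "g (\<Psi> z) (?D z a) (?D z b) = g z a b" and hol: "?D z (J z a) = J (\<Psi> z) (?D z a)"
    if "z \<in> S" for z a b
    using \<Phi> that by (simp_all add: holomorphic_isometry_def \<Psi>_def Let_def)
  \<comment> \<open>the inverse of the differential of \<open>\<Psi>\<close>, written as the differential of the smooth inverse so that \<open>W\<close> is visibly differentiable\<close>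
  define W where "W z = frechet_derivative \<Psi>' (at (\<Psi> z)) c" for z
  have DW: "?D z (W z) = c" if z: "z \<in> S" for z
    using frechet_derivative_inverse[OF S(1) coord(1)[OF z]
        smooth_on_differentiable[OF smooth(2) coord(1)[OF z]] _ coord(5)]
      smooth_on_differentiable[OF smooth(1) z] coord(4)[OF z] by (simp add: W_def)
  have DF: "frechet_derivative (F \<circ> \<phi>) (at z) b = \<omega> z (W z) b" if z: "z \<in> S" for z b
  proof -
    have "((\<lambda>z. f (\<Psi> z)) has_derivative (\<lambda>b. frechet_derivative f (at (\<Psi> z)) (?D z b))) (at z)"
      by (rule has_derivative_compose[OF smooth_on_has_derivative[OF smooth(1) z]
            smooth_on_has_derivative[OF f(1) coord(1)[OF z]]])
    then have "((F \<circ> \<phi>) has_derivative (\<lambda>b. frechet_derivative f (at (\<Psi> z)) (?D z b))) (at z)"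
      by (rule has_derivative_transform_within_open[OF _ S(1) z]) (simp add: F \<Psi>_def)
    then have "frechet_derivative (F \<circ> \<phi>) (at z) b = frechet_derivative f (at (\<Psi> z)) (?D z b)"
      by (simp add: frechet_derivative_at[symmetric])
    also have "\<dots> = g (\<Psi> z) (J (\<Psi> z) (?D z (W z))) (?D z b)"
      by (simp add: f(2)[OF coord(1)[OF z], symmetric] \<omega>[OF coord(1)[OF z]] DW[OF z])
    also have "\<dots> = \<omega> z (W z) b"
      by (simp add: hol[OF z, symmetric] iso[OF z] \<omega>[OF z])
    finally show ?thesis .
  qed
  have ham: "hamiltonian_field \<omega> (F \<circ> \<phi>) z = W z" if z: "z \<in> S" for z
    unfolding hamiltonian_field_def
  proof (rule the_equality)
    show "\<forall>b. \<omega> z (W z) b = frechet_derivative (F \<circ> \<phi>) (at z) b"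
      by (simp add: DF[OF z])
    show "a = W z" if "\<forall>b. \<omega> z a b = frechet_derivative (F \<circ> \<phi>) (at z) b" for a
      using that by (intro nondegenerate[OF z]) (simp add: DF[OF z])
  qed
  have ham_diff: "hamiltonian_field \<omega> (F \<circ> \<phi>) differentiable at z" if z: "z \<in> S" for z
  proof -
    from has_derivative_compose[OF smooth_on_has_derivative[OF smooth(1) z]
        smooth_on_has_derivative[OF smooth_on_frechet_derivative[OF smooth(2)] coord(1)[OF z]], of c]
    have "(W has_derivative (\<lambda>h. frechet_derivative (\<lambda>y. frechet_derivative \<Psi>' (at y) c) (at (\<Psi> z)) (?D z h))) (at z)"
      by (simp add: W_def[abs_def])
    then show ?thesis
      by (intro differentiableI, rule has_derivative_transform_within_open[OF _ S(1) z]) (simp_all add: ham)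
  qed
  have "smooth_on S (F \<circ> \<phi>)"
    unfolding smooth_on_def
  proof
    fix k
    have "ck_on k S (\<lambda>z. f (\<Psi> z))"
    proof (rule ck_on_compose[OF S(1) S(1), where f = \<Psi> and g = f])
      show "\<Psi> ` S \<subseteq> S"
        using coord(1) by blast
      show "ck_on k S \<Psi>" "ck_on k S f"
        using smooth(1) f(1) by (simp_all add: smooth_on_def)
    qed
    then show "ck_on k S (F \<circ> \<phi>)"
      by (rule ck_on_cong[OF S(1), rotated]) (simp add: F \<Psi>_def)
  qed
  moreover have "lie_derivative_form (hamiltonian_field \<omega> (F \<circ> \<phi>)) g Y Z z = 0"
    if Y: "smooth_on S Y" and Z: "smooth_on S Z" and z: "z \<in> S" for Y Z z
  proof (rule lie_derivative_form_pullback_constant[OF S(1) z, where \<Psi> = \<Psi> and c = c])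
    show "ck_on (Suc (Suc 0)) S \<Psi>"
      using smooth(1) unfolding smooth_on_def by (rule spec)
    show "\<Psi> ` S \<subseteq> S"
      using coord(1) by auto
    show "?D y (hamiltonian_field \<omega> (F \<circ> \<phi>) y) = c" if "y \<in> S" for y
      by (simp add: ham DW that)
  qed (fact iso ham_diff[OF z] g invariant smooth_on_differentiable[OF Y z] smooth_on_differentiable[OF Z z])+
  ultimately show ?thesis
    by (simp add: kaehler_function_def)
qed

section \<open>The Fisher metric and the exponential connection in natural parameters\<close>

lemma abs_exp_minus_one_le: "\<bar>exp t - 1\<bar> \<le> \<bar>t\<bar> * exp \<bar>t\<bar>" for t :: real
proof (cases "0 \<le> t")
  case True
  have "1 - t \<le> exp (- t)"
    using exp_ge_add_one_self[of "- t"] by simp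
  then have "(1 - t) * exp t \<le> exp (- t) * exp t"
    by (rule mult_right_mono) simp
  then have "exp t - 1 \<le> t * exp t"
    by (simp add: algebra_simps flip: exp_add)
  with True show ?thesis
    by simp
next
  case False
  then have "exp t \<le> 1"
    by simp
  then have "\<bar>exp t - 1\<bar> \<le> \<bar>t\<bar>"
    using exp_ge_add_one_self[of t] by linarith
  also have "\<dots> \<le> \<bar>t\<bar> * exp \<bar>t\<bar>"
    by (simp add: mult_le_cancel_left1)
  finally show ?thesis .
qed

context exponential_family
begin

lemma has_derivative_linear_statistic:
  "((\<lambda>\<theta>::real^'n. \<Sum>i\<in>UNIV. \<theta> $ i * F i x) has_derivative (\<lambda>v. \<Sum>i\<in>UNIV. v $ i * F i x)) (at \<theta>)"
  by (intro has_derivative_sum has_derivative_mult_left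
      bounded_linear.has_derivative[OF bounded_linear_vec_nth] has_derivative_ident)

lemma sum_axis: "(\<Sum>k\<in>UNIV. (axis i 1 :: real^'n) $ k * f k) = f i"
proof -
  have "(\<Sum>k\<in>UNIV. (axis i 1 :: real^'n) $ k * f k) = (\<Sum>k\<in>UNIV. if k = i then f k else 0)"
    by (intro sum.cong) (auto simp: axis_def)
  then show ?thesis
    by simp
qed

lemma score_eq:
  assumes "\<theta> \<in> \<Theta>"
  shows "score p i \<theta> x = F i x - pderiv_at i \<psi> \<theta>"
proof -
  have "(\<lambda>\<theta>. ln (p \<theta> x)) = (\<lambda>\<theta>. C x + (\<Sum>i\<in>UNIV. \<theta> $ i * F i x) - \<psi> \<theta>)"
    by (simp add: p_def ef_density_def)
  moreover have "((\<lambda>\<theta>. C x + (\<Sum>i\<in>UNIV. \<theta> $ i * F i x) - \<psi> \<theta>) has_derivative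
      (\<lambda>v. 0 + (\<Sum>i\<in>UNIV. v $ i * F i x) - frechet_derivative \<psi> (at \<theta>) v)) (at \<theta>)"
    by (intro has_derivative_diff has_derivative_add has_derivative_const
        has_derivative_linear_statistic smooth_on_has_derivative[OF smooth_psi assms])
  ultimately show ?thesis
    by (simp add: score_def pderiv_at_def frechet_derivative_at[symmetric] sum_axis)
qed

lemma smooth_mean: "smooth_on \<Theta> (pderiv_at i \<psi>)"
  using smooth_on_frechet_derivative[OF smooth_psi] by (simp add: pderiv_at_def[abs_def])

lemma score2_eq:
  assumes "\<theta> \<in> \<Theta>"
  shows "score2 p i j \<theta> x = - pderiv_at i (pderiv_at j \<psi>) \<theta>"
proof -
  have "((\<lambda>\<theta>. F j x - pderiv_at j \<psi> \<theta>) has_derivative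
      (\<lambda>v. 0 - frechet_derivative (pderiv_at j \<psi>) (at \<theta>) v)) (at \<theta>)"
    by (intro has_derivative_diff has_derivative_const smooth_on_has_derivative[OF smooth_mean assms])
  then have "((\<lambda>\<theta>. score p j \<theta> x) has_derivative
      (\<lambda>v. 0 - frechet_derivative (pderiv_at j \<psi>) (at \<theta>) v)) (at \<theta>)"
    by (rule has_derivative_transform_within_open[OF _ open_param assms]) (simp add: score_eq)
  then show ?thesis
    by (simp add: score2_def pderiv_at_def frechet_derivative_at[symmetric])
qed

lemma measurable_density [measurable]: "p \<theta> \<in> borel_measurable M"
  using measurable_C measurable_F unfolding p_def ef_density_def[abs_def] by measurable

lemma integrable_density: "integrable M (p \<theta>)" and integral_density: "(\<integral>x. p \<theta> x \<partial>M) = 1"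
  if "\<theta> \<in> \<Theta>"
proof -
  interpret prob_space "density M (\<lambda>x. ennreal (p \<theta> x))"
    by (rule prob_density[OF that])
  have nonneg: "0 \<le> p \<theta> x" for x
    by (simp add: p_def ef_density_def)
  have "(\<integral>\<^sup>+x. ennreal (p \<theta> x) \<partial>M) = emeasure (density M (\<lambda>x. ennreal (p \<theta> x))) (space M)"
    by (subst emeasure_density) (auto intro!: nn_integral_cong)
  also have "\<dots> = ennreal 1"
    using emeasure_space_1 by simp
  finally have "has_bochner_integral M (p \<theta>) 1"
    using nonneg by (intro has_bochner_integral_nn_integral) auto
  then show "integrable M (p \<theta>)" "(\<integral>x. p \<theta> x \<partial>M) = 1"
    by (simp_all add: has_bochner_integral_iff)
qed

text \<open>
  The second derivatives of the log-likelihood are constant on the sample space, and the score has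
  mean zero.  Hence the natural parameters are flat coordinates for the exponential connection.
\<close>

lemma exp_christoffel_eq_0:
  assumes "\<theta> \<in> \<Theta>"
  shows "exp_christoffel M p \<theta> i j k = 0"
proof -
  have "exp_christoffel M p \<theta> i j k =
      (\<integral>x. - pderiv_at i (pderiv_at j \<psi>) \<theta> * (F k x * p \<theta> x - pderiv_at k \<psi> \<theta> * p \<theta> x) \<partial>M)"
    by (simp add: exp_christoffel_def score_eq[OF assms] score2_eq[OF assms] left_diff_distrib mult.assoc)
  also have "\<dots> = - pderiv_at i (pderiv_at j \<psi>) \<theta> *
      ((\<integral>x. F k x * p \<theta> x \<partial>M) - pderiv_at k \<psi> \<theta> * (\<integral>x. p \<theta> x \<partial>M))"
    using integrable_F[OF assms, of k] integrable_density[OF assms] by simp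
  also have "\<dots> = 0"
    by (simp add: expectation_F[OF assms] integral_density[OF assms])
  finally show ?thesis .
qed

text \<open>
  The densities without the factor \<open>exp (- \<psi> \<theta>)\<close>.  A shift of the parameter multiplies them by an
  exponential of a single statistic, so that difference quotients of their integrals are easy to
  dominate.
\<close>

definition unnormalized :: "real^'n \<Rightarrow> 'w \<Rightarrow> real" where
  "unnormalized \<theta> x = exp (C x + (\<Sum>i\<in>UNIV. \<theta> $ i * F i x))"

lemma unnormalized_eq: "unnormalized \<theta> x = exp (\<psi> \<theta>) * p \<theta> x"
  by (simp add: unnormalized_def p_def ef_density_def flip: exp_add)

lemma unnormalized_shift:
  "unnormalized (\<theta> + s *\<^sub>R axis j 1) x = unnormalized \<theta> x * exp (s * F j x)"
proof -
  have "(\<Sum>i\<in>UNIV. (\<theta> + s *\<^sub>R axis j 1) $ i * F i x)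
      = (\<Sum>i\<in>UNIV. \<theta> $ i * F i x) + s * (\<Sum>i\<in>UNIV. (axis j 1 :: real^'n) $ i * F i x)"
    by (simp add: distrib_right sum.distrib sum_distrib_left mult.assoc)
  then show ?thesis
    by (simp add: unnormalized_def sum_axis flip: exp_add)
qed

lemma measurable_unnormalized [measurable]: "unnormalized \<theta> \<in> borel_measurable M"
  by (simp add: unnormalized_eq[abs_def])

lemma first_moment_unnormalized:
  assumes "\<theta> \<in> \<Theta>"
  shows "integrable M (\<lambda>x. F i x * unnormalized \<theta> x)"
    and "(\<integral>x. F i x * unnormalized \<theta> x \<partial>M) = exp (\<psi> \<theta>) * pderiv_at i \<psi> \<theta>"
proof -
  have eq: "(\<lambda>x. F i x * unnormalized \<theta> x) = (\<lambda>x. exp (\<psi> \<theta>) * (F i x * p \<theta> x))"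
    by (simp add: unnormalized_eq mult.left_commute)
  show "integrable M (\<lambda>x. F i x * unnormalized \<theta> x)"
    "(\<integral>x. F i x * unnormalized \<theta> x \<partial>M) = exp (\<psi> \<theta>) * pderiv_at i \<psi> \<theta>"
    unfolding eq using integrable_F[OF assms, of i] by (simp_all add: expectation_F[OF assms])
qed

lemma second_moment_unnormalized:
  assumes \<theta>: "\<theta> \<in> \<Theta>"
  shows "integrable M (\<lambda>x. F i x * F j x * unnormalized \<theta> x)"
    and "(\<integral>x. F i x * F j x * unnormalized \<theta> x \<partial>M)
      = exp (\<psi> \<theta>) * (fisher M p \<theta> $ i $ j + pderiv_at i \<psi> \<theta> * pderiv_at j \<psi> \<theta>)"
proof -
  let ?\<eta> = "\<lambda>i. pderiv_at i \<psi> \<theta>"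
  have eq: "(\<lambda>x. F i x * F j x * unnormalized \<theta> x) = (\<lambda>x. exp (\<psi> \<theta>) *
      (score p i \<theta> x * score p j \<theta> x * p \<theta> x + ?\<eta> i * (F j x * p \<theta> x) + ?\<eta> j * (F i x * p \<theta> x)
        - ?\<eta> i * ?\<eta> j * p \<theta> x))"
    by (simp add: score_eq[OF \<theta>] unnormalized_eq algebra_simps)
  show "integrable M (\<lambda>x. F i x * F j x * unnormalized \<theta> x)"
    unfolding eq using fisher_integrable[OF \<theta>, of i j] integrable_F[OF \<theta>] integrable_density[OF \<theta>]
    
    by (intro integrable_mult_right Bochner_Integration.integrable_diff
        Bochner_Integration.integrable_add) auto
  show "(\<integral>x. F i x * F j x * unnormalized \<theta> x \<partial>M)
      = exp (\<psi> \<theta>) * (fisher M p \<theta> $ i $ j + ?\<eta> i * ?\<eta> j)"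
    unfolding eq using fisher_integrable[OF \<theta>, of i j] integrable_F[OF \<theta>] integrable_density[OF \<theta>]
    by (simp add: expectation_F[OF \<theta>] integral_density[OF \<theta>] fisher_def)
qed

text \<open>
  The Fisher information is the Hessian of \<open>\<psi>\<close>.  The derivative of
  \<open>\<theta> \<mapsto> \<integral> F\<^sub>i unnormalized \<theta> = exp (\<psi> \<theta>) \<partial>\<^sub>i\<psi> \<theta>\<close> in direction \<open>j\<close> is computed twice: by the
  product rule, and under the integral sign.  The latter is justified by dominated convergence, using
  \<open>\<bar>exp (s y) - 1\<bar> / s \<le> \<bar>y\<bar> (exp (\<delta> y) + exp (- \<delta> y))\<close> for \<open>0 < s \<le> \<delta>\<close>: the resulting
  majorant consists of second moments at the parameters \<open>\<theta> \<plusminus> \<delta> e\<^sub>j\<close>, which are finite because these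
  parameters still lie in \<open>\<Theta>\<close>.
\<close>

lemma fisher_eq_hessian:
  assumes \<theta>: "\<theta> \<in> \<Theta>"
  shows "fisher M p \<theta> $ i $ j = pderiv_at j (pderiv_at i \<psi>) \<theta>"
proof -
  let ?e = "axis j 1 :: real^'n"
  let ?N = "\<lambda>\<theta>. exp (\<psi> \<theta>) * pderiv_at i \<psi> \<theta>"
  let ?q = "\<lambda>s x. F i x * unnormalized \<theta> x * ((exp (s * F j x) - 1) / s)"
  obtain \<delta> where \<delta>: "0 < \<delta>" "cball \<theta> \<delta> \<subseteq> \<Theta>"
    using open_param \<theta> open_contains_cball by blast
  have shift: "\<theta> + s *\<^sub>R ?e \<in> \<Theta>" if "\<bar>s\<bar> \<le> \<delta>" for s
    using \<delta>(2) that by (auto simp: dist_norm norm_axis_1 intro!: subsetD[OF \<delta>(2)])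
  define s where "s n = \<delta> / real (Suc n)" for n
  have s: "0 < s n" "\<bar>s n\<bar> \<le> \<delta>" for n
    using \<delta>(1) by (simp_all add: s_def divide_le_eq mult_le_cancel_left1)
  have "s \<longlonglongrightarrow> 0"
    unfolding s_def using LIMSEQ_Suc[OF lim_const_over_n[of \<delta>]] by simp
  then have s_at: "filterlim s (at 0) sequentially"
    using s(1) by (intro filterlim_atI) (auto intro!: always_eventually simp: less_imp_neq[symmetric])
  have quotient: "(\<integral>x. ?q (s n) x \<partial>M) = (?N (\<theta> + s n *\<^sub>R ?e) - ?N \<theta>) / s n" for n
  proof -
    have "(\<integral>x. ?q (s n) x \<partial>M) = (\<integral>x. (F i x * unnormalized (\<theta> + s n *\<^sub>R ?e) x - F i x * unnormalized \<theta> x) / s n \<partial>M)"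
      by (simp add: unnormalized_shift algebra_simps diff_divide_distrib)
    then show ?thesis
      using first_moment_unnormalized[OF \<theta>, of i] first_moment_unnormalized[OF shift[OF s(2)], of i n]
      by simp
  qed
  have "(\<lambda>n. \<integral>x. ?q (s n) x \<partial>M) \<longlonglongrightarrow> (\<integral>x. F i x * F j x * unnormalized \<theta> x \<partial>M)"
  proof (rule integral_dominated_convergence)
    let ?dom = "\<lambda>x. \<bar>F i x * F j x * unnormalized (\<theta> + \<delta> *\<^sub>R ?e) x\<bar>
      + \<bar>F i x * F j x * unnormalized (\<theta> + (- \<delta>) *\<^sub>R ?e) x\<bar>"
    show "integrable M ?dom"
      using \<delta>(1) by (intro Bochner_Integration.integrable_add integrable_abs
          second_moment_unnormalized(1) shift) auto
    show "AE x in M. (\<lambda>n. ?q (s n) x) \<longlonglongrightarrow> F i x * F j x * unnormalized \<theta> x"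
    proof (rule AE_I2)
      fix x
      have "((\<lambda>s. exp (s * F j x)) has_real_derivative F j x) (at 0)"
        by (auto intro!: derivative_eq_intros)
      then have "((\<lambda>s. (exp (s * F j x) - 1) / s) \<longlongrightarrow> F j x) (at 0)"
        by (simp add: DERIV_def)
      from tendsto_mult_left[OF filterlim_compose[OF this s_at], of "F i x * unnormalized \<theta> x"]
      show "(\<lambda>n. ?q (s n) x) \<longlonglongrightarrow> F i x * F j x * unnormalized \<theta> x"
        by (simp add: ac_simps)
    qed
    show "AE x in M. norm (?q (s n) x) \<le> ?dom x" for n
    proof (rule AE_I2)
      fix x
      have Z: "0 < unnormalized \<theta> x"
        by (simp add: unnormalized_def)
      have "\<bar>exp (s n * F j x) - 1\<bar> \<le> \<bar>s n * F j x\<bar> * exp \<bar>s n * F j x\<bar>"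
        by (rule abs_exp_minus_one_le)
      also have "exp \<bar>s n * F j x\<bar> \<le> exp (\<delta> * \<bar>F j x\<bar>)"
        using s[of n] by (simp add: abs_mult mult_right_mono)
      also have "exp (\<delta> * \<bar>F j x\<bar>) \<le> exp (\<delta> * F j x) + exp (- \<delta> * F j x)"
        by (cases "0 \<le> F j x") (simp_all add: abs_if)
      finally have "\<bar>exp (s n * F j x) - 1\<bar> \<le> s n * (\<bar>F j x\<bar> * (exp (\<delta> * F j x) + exp (- \<delta> * F j x)))"
        using s(1)[of n] by (simp add: abs_mult mult_left_mono mult.assoc)
      then have "\<bar>(exp (s n * F j x) - 1) / s n\<bar> \<le> \<bar>F j x\<bar> * (exp (\<delta> * F j x) + exp (- \<delta> * F j x))"
        using s(1)[of n] by (simp add: abs_divide divide_le_eq mult.commute)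
      then have "\<bar>F i x * unnormalized \<theta> x\<bar> * \<bar>(exp (s n * F j x) - 1) / s n\<bar>
          \<le> \<bar>F i x * unnormalized \<theta> x\<bar> * (\<bar>F j x\<bar> * (exp (\<delta> * F j x) + exp (- \<delta> * F j x)))"
        by (rule mult_left_mono) simp
      also have "\<dots> = ?dom x"
        using Z by (simp only: unnormalized_shift abs_mult abs_exp_cancel) (simp add: algebra_simps)
      finally show "norm (?q (s n) x) \<le> ?dom x"
        by (simp add: abs_mult)
    qed
  qed (use measurable_F in measurable)
  then have lim1: "(\<lambda>n. (?N (\<theta> + s n *\<^sub>R ?e) - ?N \<theta>) / s n) \<longlonglongrightarrow>
      exp (\<psi> \<theta>) * (fisher M p \<theta> $ i $ j + pderiv_at i \<psi> \<theta> * pderiv_at j \<psi> \<theta>)"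
    by (simp only: quotient second_moment_unnormalized(2)[OF \<theta>])
  have N': "(?N has_derivative (\<lambda>v. exp (\<psi> \<theta>) * frechet_derivative (pderiv_at i \<psi>) (at \<theta>) v
      + exp (\<psi> \<theta>) * frechet_derivative \<psi> (at \<theta>) v * pderiv_at i \<psi> \<theta>)) (at \<theta>)"
    by (rule has_derivative_eq_rhs[OF has_derivative_mult[OF
            has_derivative_exp[OF smooth_on_has_derivative[OF smooth_psi \<theta>]]
            smooth_on_has_derivative[OF smooth_mean \<theta>]]])
      (simp add: fun_eq_iff mult.commute)
  let ?d = "exp (\<psi> \<theta>) * pderiv_at j (pderiv_at i \<psi>) \<theta> + exp (\<psi> \<theta>) * pderiv_at j \<psi> \<theta> * pderiv_at i \<psi> \<theta>"
  have "((\<lambda>t. \<theta> + t *\<^sub>R ?e) has_derivative (\<lambda>h. h *\<^sub>R ?e)) (at 0)"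
    by (auto intro!: derivative_eq_intros)
  from has_derivative_compose[OF this, of ?N] N'
  have *: "((\<lambda>t. ?N (\<theta> + t *\<^sub>R ?e)) has_derivative
      (\<lambda>h. exp (\<psi> \<theta>) * frechet_derivative (pderiv_at i \<psi>) (at \<theta>) (h *\<^sub>R ?e)
      + exp (\<psi> \<theta>) * frechet_derivative \<psi> (at \<theta>) (h *\<^sub>R ?e) * pderiv_at i \<psi> \<theta>)) (at 0)"
    by simp
  have "((\<lambda>t. ?N (\<theta> + t *\<^sub>R ?e)) has_real_derivative ?d) (at 0)"
    unfolding has_field_derivative_def
    by (rule has_derivative_eq_rhs[OF *])
      (simp add: fun_eq_iff pderiv_at_def[of j] algebra_simps
        linear_scale[OF has_derivative_linear[OF smooth_on_has_derivative[OF smooth_psi \<theta>]]]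
        linear_scale[OF has_derivative_linear[OF smooth_on_has_derivative[OF smooth_mean \<theta>]]])
  then have "((\<lambda>t. (?N (\<theta> + t *\<^sub>R ?e) - ?N \<theta>) / t) \<longlongrightarrow> ?d) (at 0)"
    by (simp add: DERIV_def)
  from LIMSEQ_unique[OF lim1 filterlim_compose[OF this s_at]]
  have "exp (\<psi> \<theta>) * (fisher M p \<theta> $ i $ j + pderiv_at i \<psi> \<theta> * pderiv_at j \<psi> \<theta>)
      = exp (\<psi> \<theta>) * (pderiv_at j (pderiv_at i \<psi>) \<theta> + pderiv_at i \<psi> \<theta> * pderiv_at j \<psi> \<theta>)"
    by (simp add: algebra_simps)
  then show ?thesis
    by simp
qed

lemma expectation_statistics_span:
  assumes "X \<in> statistics_span M F"
  obtains c0 and c :: "real^'n" where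
    "\<And>\<theta>. \<theta> \<in> \<Theta> \<Longrightarrow> (\<integral>x. X x * p \<theta> x \<partial>M) = c0 + (\<Sum>i\<in>UNIV. c $ i * pderiv_at i \<psi> \<theta>)"
proof -
  obtain c0 and c :: "real^'n" where X: "\<And>x. x \<in> space M \<Longrightarrow> X x = c0 + (\<Sum>i\<in>UNIV. c $ i * F i x)"
    using assms unfolding statistics_span_def by blast
  have "(\<integral>x. X x * p \<theta> x \<partial>M) = c0 + (\<Sum>i\<in>UNIV. c $ i * pderiv_at i \<psi> \<theta>)" if \<theta>: "\<theta> \<in> \<Theta>" for \<theta>
  proof -
    have "(\<integral>x. X x * p \<theta> x \<partial>M) = (\<integral>x. c0 * p \<theta> x + (\<Sum>i\<in>UNIV. c $ i * (F i x * p \<theta> x)) \<partial>M)"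
      by (intro Bochner_Integration.integral_cong refl)
        (simp add: X distrib_right sum_distrib_right mult.assoc)
    also have "\<dots> = c0 + (\<Sum>i\<in>UNIV. c $ i * pderiv_at i \<psi> \<theta>)"
      using integrable_F[OF \<theta>] integrable_density[OF \<theta>]
      by (simp add: expectation_F[OF \<theta>] integral_density[OF \<theta>])
    finally show ?thesis .
  qed
  then show ?thesis
    by (rule that)
qed

text \<open>
  Since the means \<open>\<partial>\<^sub>i\<psi>\<close> have the Fisher matrix as their Jacobian, the differential of an expected
  statistic is the Fisher metric paired with the coefficient vector \<open>c\<close>.
\<close>

lemma has_derivative_mean_combination:
  assumes \<theta>: "\<theta> \<in> \<Theta>"
  shows "((\<lambda>\<theta>. c0 + (\<Sum>i\<in>UNIV. c $ i * pderiv_at i \<psi> \<theta>)) has_derivative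
    metric_of (fisher M p) \<theta> c) (at \<theta>)"
proof -
  let ?D = "\<lambda>i. frechet_derivative (pderiv_at i \<psi>) (at \<theta>)"
  have D: "?D i v = (\<Sum>j\<in>UNIV. fisher M p \<theta> $ i $ j * v $ j)" for i v
  proof -
    interpret linear "?D i"
      by (rule has_derivative_linear[OF smooth_on_has_derivative[OF smooth_mean \<theta>]])
    have "?D i v = ?D i (\<Sum>j\<in>UNIV. v $ j *\<^sub>R axis j 1)"
      by (simp add: basis_expansion[of v, unfolded scalar_mult_eq_scaleR])
    also have "\<dots> = (\<Sum>j\<in>UNIV. v $ j * ?D i (axis j 1))"
      by (simp add: sum scale)
    finally show ?thesis
      by (simp add: fisher_eq_hessian[OF \<theta>] pderiv_at_def mult.commute)
  qed
  have "((\<lambda>\<theta>. c0 + (\<Sum>i\<in>UNIV. c $ i * pderiv_at i \<psi> \<theta>)) has_derivative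
      (\<lambda>v. 0 + (\<Sum>i\<in>UNIV. c $ i * ?D i v))) (at \<theta>)"
    by (intro has_derivative_add has_derivative_const has_derivative_sum has_derivative_mult_right
        smooth_on_has_derivative[OF smooth_mean \<theta>])
  moreover have "(\<lambda>v. 0 + (\<Sum>i\<in>UNIV. c $ i * ?D i v)) = metric_of (fisher M p) \<theta> c"
    by (simp add: fun_eq_iff D metric_of_def sum_distrib_left ac_simps)
  ultimately show ?thesis
    by simp
qed

end

section \<open>The Kaehler structure in natural parameters\<close>

lemma bilinear_metric_of: "bilinear (metric_of h \<theta>)"
  unfolding bilinear_def metric_of_def
  by (intro allI conjI linearI)
    (simp_all add: algebra_simps sum.distrib sum_distrib_left)

context exponential_family
begin

text \<open>
  Flatness of the natural parameters makes the horizontal and vertical splitting the trivial one, so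
  that Dombrowski's tensors reduce to their product form.
\<close>

lemma connector_eq_snd:
  assumes "z \<in> \<Theta> \<times> UNIV"
  shows "connector (fisher M p) (exp_christoffel M p) z a = snd a"
  using assms by (auto simp: connector_def christoffel2_def exp_christoffel_eq_0 vec_eq_iff)

lemma split_tangent_eq:
  assumes "z \<in> \<Theta> \<times> UNIV"
  shows "split_tangent (fisher M p) (exp_christoffel M p) z a = a"
  by (simp add: split_tangent_def connector_eq_snd[OF assms])

lemma dombrowski_g_eq:
  assumes "z \<in> \<Theta> \<times> UNIV"
  shows "dombrowski_g (fisher M p) (exp_christoffel M p) z a b
    = metric_of (fisher M p) (fst z) (fst a) (fst b) + metric_of (fisher M p) (fst z) (snd a) (snd b)"
  by (simp add: dombrowski_g_def split_tangent_eq[OF assms] case_prod_beta)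

lemma dombrowski_omega_eq:
  assumes "z \<in> \<Theta> \<times> UNIV"
  shows "dombrowski_omega (fisher M p) (exp_christoffel M p) z a b
    = metric_of (fisher M p) (fst z) (fst a) (snd b) - metric_of (fisher M p) (fst z) (snd a) (fst b)"
  by (simp add: dombrowski_omega_def split_tangent_eq[OF assms] case_prod_beta)

lemma dombrowski_J_eq:
  assumes "z \<in> \<Theta> \<times> UNIV"
  shows "dombrowski_J (fisher M p) (exp_christoffel M p) z a = (- snd a, fst a)"
  by (simp add: dombrowski_J_def split_tangent_eq[OF assms] case_prod_beta)

lemma dombrowski_omega_eq_g_J:
  assumes "z \<in> \<Theta> \<times> UNIV"
  shows "dombrowski_omega (fisher M p) (exp_christoffel M p) z a b
    = dombrowski_g (fisher M p) (exp_christoffel M p) z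
        (dombrowski_J (fisher M p) (exp_christoffel M p) z a) b"
  by (simp add: dombrowski_omega_eq[OF assms] dombrowski_g_eq[OF assms] dombrowski_J_eq[OF assms]
      bilinear_lneg[OF bilinear_metric_of])

text \<open>
  Testing \<open>\<omega>(d, \<cdot>) = 0\<close> on the vector \<open>J d\<close> gives \<open>h(d\<^sub>1, d\<^sub>1) + h(d\<^sub>2, d\<^sub>2) = 0\<close>, so \<open>d\<close>
  vanishes by positivity.
\<close>

lemma dombrowski_omega_nondegenerate:
  assumes z: "z \<in> \<Theta> \<times> UNIV"
    and eq: "\<And>b. dombrowski_omega (fisher M p) (exp_christoffel M p) z a b
      = dombrowski_omega (fisher M p) (exp_christoffel M p) z a' b"
  shows "a = a'"
proof -
  let ?m = "metric_of (fisher M p) (fst z)"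
  define d where "d = a - a'"
  have "?m (fst d) (snd b) - ?m (snd d) (fst b) = 0" for b
    using eq[of b] by (simp add: dombrowski_omega_eq[OF z] d_def bilinear_lsub[OF bilinear_metric_of])
  from this[of "(- snd d, fst d)"] have sum0: "?m (fst d) (fst d) + ?m (snd d) (snd d) = 0"
    by (simp add: bilinear_rneg[OF bilinear_metric_of])
  have pos: "0 < ?m v v" if "v \<noteq> 0" for v
    using fisher_posdef that z by auto
  have nonneg: "0 \<le> ?m v v" for v
    using pos[of v] by (cases "v = 0") (simp_all add: bilinear_lzero[OF bilinear_metric_of])
  have "fst d = 0" "snd d = 0"
    using sum0 pos nonneg by (smt (verit))+
  then show ?thesis
    by (simp add: d_def prod_eq_iff)
qed

lemma bilinear_dombrowski_g:
  assumes "z \<in> \<Theta> \<times> UNIV"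
  shows "bilinear (dombrowski_g (fisher M p) (exp_christoffel M p) z)"
  unfolding bilinear_def dombrowski_g_eq[OF assms, abs_def]
  by (intro allI conjI linearI)
    (simp_all add: bilinear_ladd[OF bilinear_metric_of] bilinear_radd[OF bilinear_metric_of]
      bilinear_lmul[OF bilinear_metric_of] bilinear_rmul[OF bilinear_metric_of] distrib_left)

text \<open>
  The coefficients of \<open>g\<close> depend only on the base point, so their derivatives factor through \<open>fst\<close>
  and vanish in vertical directions.
\<close>

lemma dombrowski_g_has_derivative:
  assumes z: "z \<in> \<Theta> \<times> UNIV"
  obtains D where "linear D"
    "((\<lambda>z. dombrowski_g (fisher M p) (exp_christoffel M p) z a b) has_derivative (\<lambda>v. D (fst v))) (at z)"
proof -
  let ?h = "fisher M p"
  have \<theta>: "fst z \<in> \<Theta>" and S: "open (\<Theta> \<times> (UNIV :: (real^'n) set))"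
    using z open_param by (auto intro: open_Times)
  let ?G = "\<lambda>\<theta>. metric_of ?h \<theta> (fst a) (fst b) + metric_of ?h \<theta> (snd a) (snd b)"
  have "(\<lambda>\<theta>. ?h \<theta> $ i $ j * r * s) differentiable at (fst z)" for i j r s
    using bounded_linear.has_derivative[OF bounded_linear_vec_nth
        bounded_linear.has_derivative[OF bounded_linear_vec_nth smooth_on_has_derivative[OF fisher_smooth \<theta>]]]
    by (intro differentiable_mult differentiable_const) (rule differentiableI)
  then have "?G differentiable at (fst z)"
    unfolding metric_of_def by (intro differentiable_add differentiable_sum) auto
  then obtain D where D: "(?G has_derivative D) (at (fst z))"
    unfolding differentiable_def by blast
  have "((\<lambda>z. ?G (fst z)) has_derivative (\<lambda>v. D (fst v))) (at z)"
    by (rule has_derivative_compose[OF has_derivative_fst[OF has_derivative_ident] D])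
  then have "((\<lambda>z. dombrowski_g ?h (exp_christoffel M p) z a b) has_derivative (\<lambda>v. D (fst v))) (at z)"
    by (rule has_derivative_transform_within_open[OF _ S z]) (simp add: dombrowski_g_eq)
  with has_derivative_linear[OF D] show ?thesis
    by (rule that)
qed

end

theorem corollary5p8:
  fixes M :: "'w measure"
    and \<Theta> :: "(real^'n) set"
    and C :: "'w \<Rightarrow> real"
    and F :: "'n::finite \<Rightarrow> 'w \<Rightarrow> real"
    and \<psi> :: "real^'n \<Rightarrow> real"
    and X :: "'w \<Rightarrow> real"
    and \<Phi> :: "('w \<Rightarrow> real) \<times> ('w \<Rightarrow> real) \<Rightarrow> ('w \<Rightarrow> real) \<times> ('w \<Rightarrow> real)"
  defines "p \<equiv> ef_density C F \<psi>"
  defines "h \<equiv> fisher M p"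
    and "\<Gamma> \<equiv> exp_christoffel M p"
  assumes "exponential_family M \<Theta> C F \<psi>"
    and "X \<in> statistics_span M F"
    and "holomorphic_isometry (\<Theta> \<times> UNIV) (tangent_param p) (dombrowski_g h \<Gamma>) (dombrowski_J h \<Gamma>) \<Phi>"
  shows "kaehler_function (\<Theta> \<times> UNIV) (tangent_param p) (dombrowski_g h \<Gamma>) (dombrowski_omega h \<Gamma>)
           (\<lambda>z. \<integral>x. X x * (fst \<circ> \<Phi>) z x \<partial>M)"
proof -
  interpret exponential_family M \<Theta> C F \<psi> p
    by fact (fact p_def)
  have S: "open (\<Theta> \<times> (UNIV :: (real^'n) set))"
    by (rule open_Times[OF open_param open_UNIV])
  obtain c0 and c :: "real^'n" where mean:
    "\<And>\<theta>. \<theta> \<in> \<Theta> \<Longrightarrow> (\<integral>x. X x * p \<theta> x \<partial>M) = c0 + (\<Sum>i\<in>UNIV. c $ i * pderiv_at i \<psi> \<theta>)"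
    using expectation_statistics_span[OF \<open>X \<in> statistics_span M F\<close>] by blast
  let ?f = "\<lambda>z :: (real^'n) \<times> (real^'n). c0 + (\<Sum>i\<in>UNIV. c $ i * pderiv_at i \<psi> (fst z))"
  show ?thesis
  \<comment> \<open>the Hamiltonian field of the expected statistic with coefficients \<open>c\<close> is the constant vertical field \<open>- c\<close>\<close>
  proof (rule kaehler_function_pullback_constant_field[where J = "dombrowski_J h \<Gamma>" and \<Phi> = \<Phi>
        and f = ?f and c = "(0, - c)"])
    show "smooth_on (\<Theta> \<times> UNIV) ?f"
      unfolding smooth_on_def
    proof
      fix k
      have "ck_on k (\<Theta> \<times> (UNIV :: (real^'n) set)) (\<lambda>z. pderiv_at i \<psi> (fst z))" for i
        using smooth_mean[of i] unfolding smooth_on_def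
        by (intro ck_on_compose[OF S open_param _ ck_on_bounded_linear[OF S bounded_linear_fst]]) auto
      then show "ck_on k (\<Theta> \<times> UNIV) ?f"
        by (intro ck_on_add ck_on_const ck_on_sum S
            ck_on_bounded_linear_compose[OF S bounded_linear_mult_right])
    qed
  next
    fix z b assume z: "z \<in> \<Theta> \<times> (UNIV :: (real^'n) set)"
    then have "fst z \<in> \<Theta>"
      by auto
    from has_derivative_compose[OF has_derivative_fst[OF has_derivative_ident]
        has_derivative_mean_combination[OF this]]
    have "(?f has_derivative (\<lambda>v. metric_of h (fst z) c (fst v))) (at z)"
      by (simp add: h_def)
    then have "frechet_derivative ?f (at z) b = metric_of h (fst z) c (fst b)"
      by (simp add: frechet_derivative_at[symmetric])
    then show "dombrowski_omega h \<Gamma> z (0, - c) b = frechet_derivative ?f (at z) b"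
      using dombrowski_omega_eq[OF z, of "(0, - c)" b]
      by (simp add: h_def \<Gamma>_def bilinear_lzero[OF bilinear_metric_of] bilinear_lneg[OF bilinear_metric_of])
  next
    fix z a b assume z: "z \<in> \<Theta> \<times> (UNIV :: (real^'n) set)"
    obtain D where "linear D"
      and D: "((\<lambda>z. dombrowski_g h \<Gamma> z a b) has_derivative (\<lambda>v. D (fst v))) (at z)"
      using dombrowski_g_has_derivative[OF z] unfolding h_def \<Gamma>_def by blast
    show "(\<lambda>z. dombrowski_g h \<Gamma> z a b) differentiable at z"
      by (rule differentiableI[OF D])
    show "frechet_derivative (\<lambda>z. dombrowski_g h \<Gamma> z a b) (at z) (0, - c) = 0"
      by (simp add: frechet_derivative_at[OF D, symmetric] linear_0[OF \<open>linear D\<close>])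
  next
    fix z assume z: "z \<in> \<Theta> \<times> (UNIV :: (real^'n) set)"
    have "diffeomorphism (\<Theta> \<times> UNIV) (tangent_param p) \<Phi>"
      using assms(6) by (simp add: holomorphic_isometry_def)
    note \<Psi> = diffeomorphism_coord_rep(1,2)[OF inj_on_tangent_param this z]
    have "(fst \<circ> \<Phi>) (tangent_param p z) = p (fst (coord_rep (\<Theta> \<times> UNIV) (tangent_param p) \<Phi> z))"
      by (simp only: comp_def \<Psi>(2)[symmetric]) (simp only: tangent_param_def fst_conv)
    moreover have "fst (coord_rep (\<Theta> \<times> UNIV) (tangent_param p) \<Phi> z) \<in> \<Theta>"
      using \<Psi>(1) by auto
    ultimately show "(\<integral>x. X x * (fst \<circ> \<Phi>) (tangent_param p z) x \<partial>M)
        = ?f (coord_rep (\<Theta> \<times> UNIV) (tangent_param p) \<Phi> z)"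
      by (simp only: mean)
  qed (use assms(6) S inj_on_tangent_param dombrowski_omega_eq_g_J dombrowski_omega_nondegenerate
      bilinear_dombrowski_g in \<open>simp_all add: h_def \<Gamma>_def\<close>)
qed

end
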